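(* Let $i\in\{2,3\}$ and let $j$ be the other element of $\{2,3\}$. In the network model of the context, the average ergodic rate $\mathcal{U}_{2,i}$ (in nats/s/Hz) of the reference user associated with the $i$-th tier in Case 2 is $$\mathcal{U}_{2,i}=\frac{2\pi\lambda_i}{\mathbb{P}_{i,j}}\int_0^\infty\!\!\int_0^\infty x\,\exp\left\{-x^\beta P_i^{-1}(e^t-1)\sigma^2-\frac{\pi\lambda_i x^2}{\mathbb{P}_{i,j}}\left[1+\mathcal{Z}_1(e^t-1)+\frac{\lambda_1'}{\lambda_1}\frac{\mathcal{G}_{3,1}}{1-\mathcal{G}_{3,1}}\mathcal{Z}_2\right]\right\}\mathrm{d}t\,\mathrm{d}x,$$ where $$\mathcal{Z}_2=\mathcal{Z}_2(t)=\lim_{a\to0^+}(e^t-1)^{2/\beta}\,\frac{2a^{\frac{2-\beta}{2}}}{\beta-2}\,{}_2F_1\Big[1,1-\tfrac{2}{\beta};2-\tfrac{2}{\beta};-a^{-\beta/2}\Big].$$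
   Context: Parameters: real densities $\lambda_0>\lambda_2>\lambda_3>0$; $0<\alpha<1$; $\lambda_1=\alpha\lambda_0$; transmit powers $P_1,P_2,P_3>0$; path-loss exponent $\beta>2$; noise power $\sigma^2\ge 0$; integers $1\le M_1\le N$; $\gamma\ge 0$. The Zipf popularity is $f_n=n^{-\gamma}/\sum_{m=1}^N m^{-\gamma}$ for $1\le n\le N$, and $F(1,M_1)=\sum_{n=1}^{M_1}f_n$. Tier 1 consists of cache-enabled users, tier 2 of relays, tier 3 of base stations. Association probabilities: $\mathcal{G}_{3,1}=\Big[\sum_{m=1}^3\frac{\lambda_m}{\lambda_1}\big(\frac{P_m}{P_1}\big)^{2/\beta}\Big]^{-1}$ and, for $\{i,j\}=\{2,3\}$, $\mathbb{P}_{i,j}=\Big[\sum_{m=2}^3\frac{\lambda_m}{\lambda_i}\big(\frac{P_m}{P_i}\big)^{2/\beta}\Big]^{-1}$. Active densities: $\lambda_1'=\min\{\alpha\lambda_0,(1-\alpha)\lambda_0\,\mathcal{G}_{3,1}F(1,M_1)\}$, $\lambda_2'=\lambda_2$, $\lambda_3'=\lambda_3$. Case 2 model (the reference user, at the origin, is cache-enabled but its requested content is not cached at users; it is served by the node of maximal received power among tiers 2 and 3, lying in tier $i$): the distance $X_i$ from the reference user to its serving node has probability density $$\widehat f_{X_i}(x)=\frac{2\pi\lambda_i}{\mathbb{P}_{i,j}}\,x\,\exp\Big(-\pi x^2\sum_{m=2}^3\lambda_m\big(\tfrac{P_m}{P_i}\big)^{2/\beta}\Big),\quad x>0.$$ Conditionally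 on $X_i=x$, the interfering nodes of tiers $m=1,2,3$ form mutually independent homogeneous Poisson point processes of intensities $\lambda_m'$: for $m=2,3$ on $\{z\in\mathbb{R}^2:|z|\ge x(P_m/P_i)^{1/\beta}\}$, and for $m=1$ on all of $\mathbb{R}^2$ (tier-1 interferers can be arbitrarily close). All channel power gains ($g_{i,0}$ of the serving link and $h_{mk}$ of the interfering links) are i.i.d. $\exp(1)$ random variables, independent of all locations. With $|Y_{mk}|$ the distance from the origin to the $k$-th interferer of tier $m$, $$\mathrm{SINR}_i(x)=\frac{P_i g_{i,0}x^{-\beta}}{\sum_{m=1}^3\sum_k P_m h_{mk}|Y_{mk}|^{-\beta}+\sigma^2}.$$ The average ergodic rate is $\mathcal{U}_{2,i}=\int_0^\infty\mathbb{E}\big[\ln(1+\mathrm{SINR}_i(x))\,\big|\,X_i=x\big]\widehat f_{X_i}(x)\,\mathrm{d}x$. Function: for $s>0$, $\mathcal{Z}_1(s)=\frac{2s}{\beta-2}\,{}_2F_1\big[1,1-\tfrac{2}{\beta};2-\tfrac{2}{\beta};-s\big]$, where ${}_2F_1$ is the Gauss hypergeometric function (analytically continued to $\mathbb{C}\setminus[1,\infty)$). *)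

theory Defs
  imports "HOL-Probability.Probability" "HOL-Complex_Analysis.Complex_Analysis"
begin

section \<open>The Gauss hypergeometric function on the slit plane\<close>

text \<open>
  The analytic continuation of the Gauss series to the complement of \<open>[1,\<infinity>)\<close>. It is unique there,
  because the slit plane is connected; the values on the cut itself are unspecified.
\<close>

definition hyp2F1 :: "complex \<Rightarrow> complex \<Rightarrow> complex \<Rightarrow> complex \<Rightarrow> complex" where
  "hyp2F1 a b c = (SOME F. F holomorphic_on (- complex_of_real ` {1..}) \<and>
     (\<forall>z. norm z < 1 \<longrightarrow> F z = eval_fps (fps_hypergeo [a, b] [c] 1) z))"

text \<open>For real parameters and a real argument below \<open>1\<close> the value is real, so \<open>Re\<close> loses nothing.\<close>

definition hyp2F1_real :: "real \<Rightarrow> real \<Rightarrow> real \<Rightarrow> real \<Rightarrow> real" where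
  "hyp2F1_real a b c s =
     Re (hyp2F1 (complex_of_real a) (complex_of_real b) (complex_of_real c) (complex_of_real s))"

definition Z1 :: "real \<Rightarrow> real \<Rightarrow> real" where
  "Z1 \<beta> s = 2 * s / (\<beta> - 2) * hyp2F1_real 1 (1 - 2 / \<beta>) (2 - 2 / \<beta>) (- s)"

definition Z2 :: "real \<Rightarrow> real \<Rightarrow> real" where
  "Z2 \<beta> t = Lim (at_right 0) (\<lambda>a. (exp t - 1) powr (2 / \<beta>)
     * (2 * a powr ((2 - \<beta>) / 2) / (\<beta> - 2))
     * hyp2F1_real 1 (1 - 2 / \<beta>) (2 - 2 / \<beta>) (- (a powr (- \<beta> / 2))))"

section \<open>Poisson point processes given by an enumeration of their points\<close>

definition point_count :: "(nat \<Rightarrow> 'w \<Rightarrow> 'a) \<Rightarrow> 'a set \<Rightarrow> 'w \<Rightarrow> nat" where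
  "point_count Y B \<omega> = card {k. Y k \<omega> \<in> B}"

text \<open>
  The points \<open>Y 0 \<omega>, Y 1 \<omega>, \<dots>\<close>, counted with multiplicity, form a homogeneous Poisson point process
  of intensity \<open>\<mu>\<close> on the region \<open>A\<close>. Local finiteness is required explicitly because \<open>card\<close> of an
  infinite set is \<open>0\<close>. Almost surely no point lies outside \<open>A\<close>: a bounded set disjoint from \<open>A\<close> has
  mean count \<open>0\<close>. Indexing by all of \<open>nat\<close> presupposes infinitely many points, which is no
  restriction if \<open>\<mu> > 0\<close> and \<open>A\<close> has infinite volume.
\<close>

definition poisson_process ::
    "'w measure \<Rightarrow> real \<Rightarrow> 'a::euclidean_space set \<Rightarrow> (nat \<Rightarrow> 'w \<Rightarrow> 'a) \<Rightarrow> bool" where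
  "poisson_process S \<mu> A Y \<longleftrightarrow>
     (\<forall>k. Y k \<in> borel_measurable S) \<and>
     (\<forall>B\<in>sets borel. bounded B \<longrightarrow>
        (AE \<omega> in S. finite {k. Y k \<omega> \<in> B}) \<and>
        (\<forall>n. measure S {\<omega> \<in> space S. point_count Y B \<omega> = n} =
             (\<mu> * measure lborel (B \<inter> A)) ^ n / fact n * exp (- (\<mu> * measure lborel (B \<inter> A))))) \<and>
     (\<forall>(J :: nat set) B. finite J \<longrightarrow> disjoint_family_on B J \<longrightarrow>
        (\<forall>j\<in>J. B j \<in> sets borel \<and> bounded (B j)) \<longrightarrow>
        prob_space.indep_vars S (\<lambda>_. count_space UNIV) (\<lambda>j. point_count Y (B j)) J)"

definition generated_events ::
    "'w measure \<Rightarrow> 'i set \<Rightarrow> ('i \<Rightarrow> 'w \<Rightarrow> 'b::topological_space) \<Rightarrow> 'w set set" where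
  "generated_events S I V =
     sigma_sets (space S) (\<Union>l\<in>I. {V l -` C \<inter> space S | C. C \<in> sets borel})"

text \<open>
  The events determined by the counts only, not by the order in which the points are enumerated.
\<close>

definition process_events ::
    "'w measure \<Rightarrow> (nat \<Rightarrow> 'w \<Rightarrow> 'a::euclidean_space) \<Rightarrow> 'w set set" where
  "process_events S Y = generated_events S {B \<in> sets borel. bounded B} (point_count Y)"

section \<open>Network parameters\<close>

text \<open>
  The argument \<open>lam\<close> maps \<open>0\<close> to the density of all users and \<open>1,2,3\<close> to the tier densities
  (cache-enabled users, relays, base stations); \<open>P\<close> maps \<open>1,2,3\<close> to the transmit powers.
\<close>

definition zipf :: "nat \<Rightarrow> real \<Rightarrow> nat \<Rightarrow> real" where
  "zipf N \<gamma> n = real n powr (- \<gamma>) / (\<Sum>m=1..N. real m powr (- \<gamma>))"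

definition cache_mass :: "nat \<Rightarrow> real \<Rightarrow> nat \<Rightarrow> real" where
  "cache_mass N \<gamma> M1 = (\<Sum>n=1..M1. zipf N \<gamma> n)"

definition assoc_G31 :: "(nat \<Rightarrow> real) \<Rightarrow> (nat \<Rightarrow> real) \<Rightarrow> real \<Rightarrow> real" where
  "assoc_G31 lam P \<beta> = inverse (\<Sum>m=1..3. lam m / lam 1 * (P m / P 1) powr (2 / \<beta>))"

text \<open>
  The probability \<open>\<P>\<close> of association with tier \<open>i\<close> rather than with the other tier \<open>j\<close> of \<open>{2,3}\<close>;
  \<open>j\<close> is determined by \<open>i\<close> and does not enter the formula.
\<close>

definition assoc_P :: "(nat \<Rightarrow> real) \<Rightarrow> (nat \<Rightarrow> real) \<Rightarrow> real \<Rightarrow> nat \<Rightarrow> real" where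
  "assoc_P lam P \<beta> i = inverse (\<Sum>m=2..3. lam m / lam i * (P m / P i) powr (2 / \<beta>))"

definition active_density ::
    "(nat \<Rightarrow> real) \<Rightarrow> (nat \<Rightarrow> real) \<Rightarrow> real \<Rightarrow> real \<Rightarrow> real \<Rightarrow> nat \<Rightarrow> nat \<Rightarrow> nat \<Rightarrow> real" where
  "active_density lam P \<beta> \<alpha> \<gamma> N M1 m =
     (if m = 1
      then min (\<alpha> * lam 0) ((1 - \<alpha>) * lam 0 * assoc_G31 lam P \<beta> * cache_mass N \<gamma> M1)
      else lam m)"

section \<open>The Case 2 model\<close>

definition serving_density ::
    "(nat \<Rightarrow> real) \<Rightarrow> (nat \<Rightarrow> real) \<Rightarrow> real \<Rightarrow> nat \<Rightarrow> real \<Rightarrow> real" where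
  "serving_density lam P \<beta> i x =
     (if x > 0
      then 2 * pi * lam i / assoc_P lam P \<beta> i * x
           * exp (- pi * x\<^sup>2 * (\<Sum>m=2..3. lam m * (P m / P i) powr (2 / \<beta>)))
      else 0)"

definition interferer_region ::
    "(nat \<Rightarrow> real) \<Rightarrow> real \<Rightarrow> nat \<Rightarrow> real \<Rightarrow> nat \<Rightarrow> (real^2) set" where
  "interferer_region P \<beta> i x m =
     (if m = 1 then UNIV else {z. norm z \<ge> x * (P m / P i) powr (1 / \<beta>)})"

text \<open>
  All fading gains as one family: \<open>None\<close> indexes the serving link and \<open>Some (m, k)\<close> the link from
  the \<open>k\<close>-th interferer of tier \<open>m\<close>.
\<close>

definition gain :: "('w \<Rightarrow> real) \<Rightarrow> (nat \<Rightarrow> nat \<Rightarrow> 'w \<Rightarrow> real) \<Rightarrow> (nat \<times> nat) option \<Rightarrow> 'w \<Rightarrow> real" where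
  "gain g h l = (case l of None \<Rightarrow> g | Some (m, k) \<Rightarrow> h m k)"

definition links :: "(nat \<times> nat) option set" where
  "links = insert None (Some ` ({1..3} \<times> UNIV))"

text \<open>
  The law of the network given that the serving node, in tier \<open>i\<close>, is at distance \<open>x\<close>; \<open>S\<close> is the
  conditional probability measure and \<open>lam'\<close> the densities of the active tiers.
\<close>

definition case2_law ::
    "(nat \<Rightarrow> real) \<Rightarrow> (nat \<Rightarrow> real) \<Rightarrow> real \<Rightarrow> nat \<Rightarrow> ('w \<Rightarrow> real) \<Rightarrow> (nat \<Rightarrow> nat \<Rightarrow> 'w \<Rightarrow> real) \<Rightarrow>
     (nat \<Rightarrow> nat \<Rightarrow> 'w \<Rightarrow> real^2) \<Rightarrow> real \<Rightarrow> 'w measure \<Rightarrow> bool" where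
  "case2_law lam' P \<beta> i g h Y x S \<longleftrightarrow>
     prob_space S \<and>
     (\<forall>m\<in>{1..3}. poisson_process S (lam' m) (interferer_region P \<beta> i x m) (Y m)) \<and>
     prob_space.indep_sets S (\<lambda>m. process_events S (Y m)) {1..3} \<and>
     (\<forall>l\<in>links. distributed S lborel (gain g h l) (\<lambda>y. ennreal (exponential_density 1 y))) \<and>
     prob_space.indep_vars S (\<lambda>_. borel) (gain g h) links \<and>
     prob_space.indep_set S (generated_events S links (gain g h))
       (generated_events S ({1..3} \<times> UNIV) (\<lambda>(m, k). Y m k))"

text \<open>\<open>K x\<close> is a version of the conditional probability measure given \<open>X = x\<close>.\<close>

definition regular_conditional :: "'w measure \<Rightarrow> ('w \<Rightarrow> real) \<Rightarrow> (real \<Rightarrow> 'w measure) \<Rightarrow> bool" where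
  "regular_conditional M X K \<longleftrightarrow>
     K \<in> borel \<rightarrow>\<^sub>M prob_algebra M \<and>
     (\<forall>A\<in>sets M. \<forall>B\<in>sets borel.
        emeasure M (A \<inter> X -` B) = (\<integral>\<^sup>+x\<in>B. emeasure (K x) A \<partial>distr M borel X))"

definition interference ::
    "(nat \<Rightarrow> real) \<Rightarrow> real \<Rightarrow> (nat \<Rightarrow> nat \<Rightarrow> 'w \<Rightarrow> real) \<Rightarrow> (nat \<Rightarrow> nat \<Rightarrow> 'w \<Rightarrow> real^2) \<Rightarrow> 'w \<Rightarrow> real"
  where
  "interference P \<beta> h Y \<omega> =
     (\<Sum>m=1..3. \<Sum>k. P m * h m k \<omega> * norm (Y m k \<omega>) powr (- \<beta>))"

definition sinr ::
    "(nat \<Rightarrow> real) \<Rightarrow> real \<Rightarrow> real \<Rightarrow> nat \<Rightarrow> ('w \<Rightarrow> real) \<Rightarrow> (nat \<Rightarrow> nat \<Rightarrow> 'w \<Rightarrow> real) \<Rightarrow>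
     (nat \<Rightarrow> nat \<Rightarrow> 'w \<Rightarrow> real^2) \<Rightarrow> real \<Rightarrow> 'w \<Rightarrow> real" where
  "sinr P \<beta> \<sigma> i g h Y x \<omega> =
     P i * g \<omega> * x powr (- \<beta>) / (interference P \<beta> h Y \<omega> + \<sigma>\<^sup>2)"

text \<open>
  The integrands are (almost surely) nonnegative, so the rate is taken in \<open>[0,\<infinity>]\<close>; no value is lost
  to the convention that the Bochner integral of a non-integrable function is \<open>0\<close>.
\<close>

definition ergodic_rate ::
    "(nat \<Rightarrow> real) \<Rightarrow> (nat \<Rightarrow> real) \<Rightarrow> real \<Rightarrow> real \<Rightarrow> nat \<Rightarrow> (real \<Rightarrow> 'w measure) \<Rightarrow>
     ('w \<Rightarrow> real) \<Rightarrow> (nat \<Rightarrow> nat \<Rightarrow> 'w \<Rightarrow> real) \<Rightarrow> (nat \<Rightarrow> nat \<Rightarrow> 'w \<Rightarrow> real^2) \<Rightarrow> ennreal" where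
  "ergodic_rate lam P \<beta> \<sigma> i K g h Y =
     (\<integral>\<^sup>+x\<in>{0<..}. (\<integral>\<^sup>+\<omega>. ennreal (ln (1 + sinr P \<beta> \<sigma> i g h Y x \<omega>)) \<partial>K x)
        * ennreal (serving_density lam P \<beta> i x) \<partial>lborel)"

end

theory Submission
  imports Defs
begin

text \<open>
  Let \<open>w = x\<^sup>\<beta> (I + \<sigma>\<^sup>2) / P\<^sub>i\<close> with \<open>I\<close> the interference, so that the SINR is \<open>g / w\<close>. Since \<open>g\<close> is exponential
  and independent of \<open>w\<close>, the expectation of \<open>ln (1 + g / w)\<close> is the integral over \<open>t > 0\<close> of the
  expectation of \<open>exp (- (exp t - 1) w)\<close>, that is, of the Laplace transform of the interference.
  Averaging over the exponential gains turns the Laplace transform into a product of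
  \<open>1 / (1 + s P\<^sub>m |Y\<^sub>m\<^sub>k|\<^bsup>-\<beta>\<^esup>)\<close> over the interferers. This product does not depend on the
  enumeration of the points, and the generating functional of a Poisson process evaluates its mean
  as the exponential of a radial integral. Polar coordinates and Euler's integral for the
  hypergeometric function identify the radial integrals outside a disc with \<open>Z1\<close> and over the
  whole plane with \<open>Z2\<close>.
\<close>

section \<open>Euler integral of the hypergeometric function\<close>

text \<open>The mean of the tier-1 interference is infinite whenever that tier has positive density:
  |z|^(-\<beta>) is not integrable at the origin and no disc is excluded there. Convergence of the
  interference series therefore cannot be read off from its mean; it is extracted from the Laplace
  transforms of the partial sums, whose limit tends to 1 as s -> 0. Averaging over a gain replaces
  the singular path loss by a kernel with values in [0, 1], so that only the decay at infinity
  matters, and there \<beta> > 2 suffices. The counts carry the Poisson law and the independence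
  between tiers, while the interference is a series over an enumeration of unknown law. A finite
  partial product depends on the enumeration, but for a simple function of bounded support the
  partial products become constant and equal an expression in counts. In the final bracket the
  summand 1 comes from the serving density, and G / (1 - G), the odds of tier 1 against tiers 2 and
  3, from measuring the weight of tier 1 in units of the total weight of the other two.\<close>

lemma slit_eq: "complex_of_real ` {1..} = {z. Im z = 0 \<and> 1 \<le> Re z}"
  by (auto simp: image_iff complex_eq_iff)

lemma open_slit_plane: "open (- complex_of_real ` {1..})"
  unfolding slit_eq by (intro open_Compl closed_Collect_conj closed_Collect_eq closed_Collect_le continuous_intros)

text \<open>The slit is where the integrand of Euler's integral can have a pole: a zero at
  \<open>w\<close> in (0, 1] forces \<open>z = 1 / w\<close>, which lies in [1,
  \<infinity>).\<close>

lemma slit_plane_denominator: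
  assumes "z \<in> - complex_of_real ` {1..}" "0 \<le> w" "w \<le> 1"
  shows "1 - z * complex_of_real w \<noteq> 0"
proof
  assume *: "1 - z * complex_of_real w = 0"
  then have "w \<noteq> 0" by auto
  then have "z = complex_of_real (1 / w)" "1 / w \<ge> 1" using * assms(2,3) by (auto simp: field_simps)
  then show False using assms(1) by blast
qed

text \<open>The slit plane is star-shaped about 0: a point \<open>z t = r\<close> with
  \<open>r \<ge> 1\<close> on the segment would give a zero of \<open>1 - z w\<close> at
  \<open>w = t / r\<close> in [0, 1]. Connectedness is what the identity theorem needs
  later.\<close>

lemma connected_slit_plane: "connected (- complex_of_real ` {1..})"
proof (rule starlike_imp_connected, unfold starlike_def, intro bexI[of _ 0] ballI subsetI)
  fix z u assume z: "z \<in> - complex_of_real ` {1..}" and "u \<in> closed_segment 0 z"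
  then obtain t where t: "0 \<le> t" "t \<le> 1" "u = z * complex_of_real t"
    by (auto simp: closed_segment_def scaleR_conv_of_real mult.commute)
  show "u \<in> - complex_of_real ` {1..}"
  proof
    assume "u \<in> complex_of_real ` {1..}"
    then obtain r where r: "r \<ge> 1" "u = complex_of_real r" by auto
    have "1 - z * complex_of_real (t / r) = 0" using r t by (simp add: mult.commute)
    moreover have "t / r \<le> 1" "0 \<le> t / r" using r t by auto
    ultimately show False using slit_plane_denominator[OF z] by blast
  qed
qed auto

text \<open>Euler's integral \<open>b \<integral>\<^sub>0\<^sup>1 t\<^bsup>b-1\<^esup> / (1 - z t) dt\<close> after the substitution \<open>t = v\<^bsup>1/b\<^esup>\<close>,
  which removes the singularity at \<open>0\<close>.\<close>

definition hyp_euler :: "real \<Rightarrow> complex \<Rightarrow> complex" where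
  "hyp_euler p z = integral {0..1} (\<lambda>v. 1 / (1 - z * complex_of_real (v powr p)))"

lemma powr_unit_interval:
  fixes v p :: real
  assumes "p > 0" "v \<in> {0..1}" shows "0 \<le> v powr p" "v powr p \<le> 1"
  using assms by (auto intro: powr_le1)

text \<open>Differentiation under the integral sign. The rule asks for a convex domain, which the
  slit plane is not, so it is applied on balls inside it.\<close>

lemma holomorphic_hyp_euler:
  assumes "p > 0"
  shows "hyp_euler p holomorphic_on - complex_of_real ` {1..}"
  unfolding holomorphic_on_open[OF open_slit_plane]
proof
  fix z assume "z \<in> - complex_of_real ` {1..}"
  then obtain e where e: "e > 0" "ball z e \<subseteq> - complex_of_real ` {1..}"
    using open_slit_plane openE by blast
  have nz: "1 - u * complex_of_real (v powr p) \<noteq> 0" if "u \<in> ball z e" "v \<in> {0..1}" for u v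
    using slit_plane_denominator powr_unit_interval[OF assms that(2)] e that by blast
  have "(\<lambda>z. integral (cbox 0 1) (\<lambda>v. 1 / (1 - z * complex_of_real (v powr p)))) holomorphic_on ball z e"
  proof (rule leibniz_rule_holomorphic[where fx = "\<lambda>z v. complex_of_real (v powr p) / (1 - z * complex_of_real (v powr p))\<^sup>2"])
    fix u and v :: real assume "u \<in> ball z e" "v \<in> cbox 0 1"
    then show "((\<lambda>z. 1 / (1 - z * complex_of_real (v powr p))) has_field_derivative
        complex_of_real (v powr p) / (1 - u * complex_of_real (v powr p))\<^sup>2) (at u within ball z e)"
      using nz by (auto intro!: derivative_eq_intros simp: power2_eq_square)
  next
    fix u assume "u \<in> ball z e"
    then show "(\<lambda>v. 1 / (1 - u * complex_of_real (v powr p))) integrable_on cbox 0 1"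
      using nz assms by (intro integrable_continuous continuous_intros continuous_on_powr') auto
  next
    show "continuous_on (ball z e \<times> cbox 0 1)
        (\<lambda>(z, v). complex_of_real (v powr p) / (1 - z * complex_of_real (v powr p))\<^sup>2)"
      unfolding split_beta using nz assms
      by (intro continuous_intros continuous_on_powr') auto
  qed auto
  then have "hyp_euler p holomorphic_on ball z e"
    by (simp add: hyp_euler_def[abs_def])
  then show "\<exists>f'. (hyp_euler p has_field_derivative f') (at z)"
    using e(1) by (auto simp: holomorphic_on_open)
qed

text \<open>The numerator parameter 1 contributes n!, which cancels the factorial of the series. The
  remaining quotient collapses because \<open>b * pochhammer (b + 1) n\<close> and
  \<open>pochhammer b n * (b + n)\<close> both equal \<open>pochhammer b (Suc n)\<close>.\<close>

lemma fps_hypergeo_Suc_nth: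
  fixes b :: complex
  assumes "\<And>n. b + of_nat n \<noteq> 0"
  shows "fps_hypergeo [1, b] [b + 1] 1 $ n = b / (b + of_nat n)"
proof -
  have p: "pochhammer b n \<noteq> 0" "pochhammer (b + 1) n \<noteq> 0" for n
    using assms by (auto simp: pochhammer_eq_0_iff add.commute add.left_commute)
       (metis add.assoc add.commute assms neg_eq_iff_add_eq_0 of_nat_Suc add_eq_0_iff2)+
  have "b * pochhammer (b + 1) n = pochhammer b n * (b + of_nat n)"
    by (metis pochhammer_rec pochhammer_Suc)
  then have "pochhammer b n / pochhammer (b + 1) n = b / (b + of_nat n)"
    using p assms[of n] by (simp add: field_simps)
  then show ?thesis by (simp add: fps_hypergeo_nth pochhammer_fact[symmetric] field_simps)
qed

text \<open>Geometric series, integrated term by term: |z v^p| \<le> |z| < 1 makes the convergence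
  uniform on [0, 1], and the integral of v^(p k) is 1 / (p k + 1) = b / (b + k), the hypergeometric
  coefficient.\<close>

lemma hyp_euler_eq_series:
  assumes b: "b > 0" and z: "norm z < 1"
  shows "hyp_euler (1 / b) z =
    eval_fps (fps_hypergeo [1, complex_of_real b] [complex_of_real (b + 1)] 1) z"
proof -
  define p where "p = 1 / b"
  have p: "p > 0" using b by (simp add: p_def)
  have le: "norm (z * complex_of_real (v powr p)) \<le> norm z" if "v \<in> {0..1}" for v
    using powr_unit_interval[OF p that] by (simp add: norm_mult mult_left_le)
  have "uniform_limit {0..1} (\<lambda>n v. \<Sum>k<n. (z * complex_of_real (v powr p)) ^ k)
      (\<lambda>v. \<Sum>k. (z * complex_of_real (v powr p)) ^ k) sequentially"
    using z le by (intro Weierstrass_m_test[where M = "\<lambda>k. norm z ^ k"])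
      (auto simp: norm_power norm_mult power_mono intro!: summable_geometric)
  then have u: "uniform_limit {0..1} (\<lambda>n v. \<Sum>k<n. (z * complex_of_real (v powr p)) ^ k)
      (\<lambda>v. 1 / (1 - z * complex_of_real (v powr p))) sequentially"
    by (rule uniform_limit_cong'[THEN iffD1, rotated -1])
       (use z le in \<open>auto intro!: suminf_geometric intro: order_le_less_trans[OF le]\<close>)
  obtain I J where I: "\<And>n. ((\<lambda>v. \<Sum>k<n. (z * complex_of_real (v powr p)) ^ k) has_integral I n) {0..1}"
    and J: "((\<lambda>v. 1 / (1 - z * complex_of_real (v powr p))) has_integral J) {0..1}"
    and IJ: "I \<longlonglongrightarrow> J"
    using uniform_limit_integral[OF u] p
    by (force intro!: continuous_intros continuous_on_powr')
  have t: "((\<lambda>v. (z * complex_of_real (v powr p)) ^ k) has_integral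
      complex_of_real b / (complex_of_real b + of_nat k) * z ^ k) {0..1}" for k
  proof -
    have "((\<lambda>v. v powr (p * real k)) has_integral (1 powr (p * real k + 1) / (p * real k + 1))) {0..1::real}"
      using p by (intro has_integral_powr_from_0) (auto intro: less_le_trans[of _ 0])
    then have "((\<lambda>v. complex_of_real (v powr (p * real k))) has_integral complex_of_real (1 / (p * real k + 1))) {0..1}"
      unfolding powr_one_eq_one by (rule has_integral_of_real)
    from has_integral_mult_right[OF this, of "z ^ k"]
    have "((\<lambda>v. z ^ k * complex_of_real (v powr (p * real k))) has_integral
        z ^ k * complex_of_real (1 / (p * real k + 1))) {0..1}" .
    moreover have "1 / (p * real k + 1) = b / (b + real k)"
      using b by (simp add: p_def field_simps)
    ultimately have "((\<lambda>v. z ^ k * complex_of_real (v powr (p * real k))) has_integral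
        complex_of_real b / (complex_of_real b + of_nat k) * z ^ k) {0..1}" by (simp add: mult.commute)
    then show ?thesis
    \<comment> \<open>The point 0 is exceptional: for \<open>k = 0\<close> the power is 1 there,
      while \<open>0 powr 0 = 0\<close>.\<close>
    proof (rule has_integral_spike[where S = "{0}", rotated 2])
      fix v :: real assume "v \<in> {0..1} - {0}"
      then have "v powr (p * real k) = (v powr p) ^ k" by (simp add: powr_powr[symmetric] powr_realpow)
      then show "(z * complex_of_real (v powr p)) ^ k = z ^ k * complex_of_real (v powr (p * real k))"
        by (simp add: power_mult_distrib)
    qed auto
  qed
  have "I n = (\<Sum>k<n. complex_of_real b / (complex_of_real b + of_nat k) * z ^ k)" for n
    by (rule has_integral_unique[OF I]) (intro has_integral_sum t; simp)
  then have "I = (\<lambda>n. \<Sum>k<n. complex_of_real b / (complex_of_real b + of_nat k) * z ^ k)" by blast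
  with IJ have "(\<lambda>k. complex_of_real b / (complex_of_real b + of_nat k) * z ^ k) sums J"
    unfolding sums_def by simp
  moreover have "complex_of_real b + of_nat n \<noteq> 0" for n
    using b by (metis add_pos_nonneg of_nat_0_le_iff of_real_0 of_real_add of_real_eq_iff of_real_of_nat_eq order_less_irrefl)
  then have "fps_hypergeo [1, complex_of_real b] [complex_of_real (b + 1)] 1 $ k =
     complex_of_real b / (complex_of_real b + of_nat k)" for k
    using fps_hypergeo_Suc_nth[of "complex_of_real b"] by simp
  ultimately have "eval_fps (fps_hypergeo [1, complex_of_real b] [complex_of_real (b + 1)] 1) z = J"
    unfolding eval_fps_def by (simp add: sums_iff)
  moreover have "hyp_euler p z = J" unfolding hyp_euler_def using J by (rule integral_unique)
  ultimately show ?thesis by (simp add: p_def)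
qed

text \<open>\<open>hyp2F1\<close> is a Hilbert choice, so a witness must come before any use of its
  properties; Euler's integral is one. Agreement with it then spreads from the unit disc to the slit
  plane by the identity theorem.\<close>

lemma hyp2F1_eq_euler:
  assumes b: "b > 0" and z: "z \<in> - complex_of_real ` {1..}"
  shows "hyp2F1 1 (complex_of_real b) (complex_of_real (b + 1)) z = hyp_euler (1 / b) z"
proof -
  let ?Q = "\<lambda>F. F holomorphic_on (- complex_of_real ` {1..}) \<and>
     (\<forall>z. norm z < 1 \<longrightarrow> F z = eval_fps (fps_hypergeo [1, complex_of_real b] [complex_of_real (b + 1)] 1) z)"
  have "?Q (hyp_euler (1 / b))"
    using holomorphic_hyp_euler[of "1 / b"] hyp_euler_eq_series[OF b] b by simp
  then have Q: "?Q (hyp2F1 1 (complex_of_real b) (complex_of_real (b + 1)))"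
    unfolding hyp2F1_def by (rule someI[of ?Q])
  show ?thesis
  proof (rule analytic_continuation_open[where s = "ball 0 1" and s' = "- complex_of_real ` {1..}"
      and f = "hyp2F1 1 (complex_of_real b) (complex_of_real (b + 1))" and g = "hyp_euler (1 / b)"])
    show "ball 0 1 \<subseteq> - complex_of_real ` {1..}" by auto
    show "hyp_euler (1 / b) holomorphic_on - complex_of_real ` {1..}"
      using b by (intro holomorphic_hyp_euler) simp
  qed (use Q b z hyp_euler_eq_series[OF b] open_slit_plane connected_slit_plane in auto)
qed

lemma hyp2F1_real_eq_integral:
  assumes b: "b > 0" and s: "s \<ge> 0"
  shows "hyp2F1_real 1 b (b + 1) (- s) = integral {0..1} (\<lambda>v. 1 / (1 + s * v powr (1 / b)))"
proof -
  have "complex_of_real (- s) \<in> - complex_of_real ` {1..}"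
    using s by (auto simp: slit_eq simp del: of_real_minus)
  then have "hyp2F1 1 (complex_of_real b) (complex_of_real (b + 1)) (complex_of_real (- s))
      = hyp_euler (1 / b) (complex_of_real (- s))"
    by (rule hyp2F1_eq_euler[OF b])
  also have "\<dots> = integral {0..1} (\<lambda>v. complex_of_real (1 / (1 + s * v powr (1 / b))))"
    unfolding hyp_euler_def by simp
  also have "\<dots> = complex_of_real (integral {0..1} (\<lambda>v. 1 / (1 + s * v powr (1 / b))))"
  proof (rule integral_unique, rule has_integral_of_real, rule integrable_integral)
    have "1 + s * v powr (1 / b) \<noteq> 0" for v
      using s by (metis add_pos_nonneg less_irrefl mult_nonneg_nonneg powr_ge_zero zero_less_one)
    then show "(\<lambda>v. 1 / (1 + s * v powr (1 / b))) integrable_on {0..1}"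
      using b by (intro integrable_continuous_interval continuous_intros continuous_on_powr') auto
  qed
  finally show ?thesis by (simp add: hyp2F1_real_def)
qed

section \<open>The path-loss integrals\<close>

text \<open>The parameters have the shape b, b + 1 with b = 1 - 2 / \<beta>, and 1 / b is the
  exponent \<beta> / (\<beta> - 2).\<close>

lemma Z1_eq_integral:
  assumes "\<beta> > 2" "T \<ge> 0"
  shows "Z1 \<beta> T = 2 * T / (\<beta> - 2) * integral {0..1} (\<lambda>v. 1 / (1 + T * v powr (\<beta> / (\<beta> - 2))))"
proof -
  have "1 - 2 / \<beta> > 0" "2 - 2 / \<beta> = (1 - 2 / \<beta>) + 1" "1 / (1 - 2 / \<beta>) = \<beta> / (\<beta> - 2)"
    using assms by (auto simp: field_simps)
  then show ?thesis
    unfolding Z1_def using hyp2F1_real_eq_integral[of "1 - 2 / \<beta>" T] assms(2) by (simp only:)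
qed

text \<open>The substitution \<open>w = v\<^bsup>-2/(\<beta>-2)\<^esup>\<close> is carried out by checking that
  \<open>2 T / (\<beta> - 2) \<integral>\<^sub>0\<^sup>u 1 / (1 + T v\<^bsup>\<beta>/(\<beta>-2)\<^esup>) dv\<close> at \<open>u = w\<^bsup>-(\<beta>-2)/2\<^esup>\<close> is minus an antiderivative.\<close>

lemma nn_integral_eq_Z1:
  assumes \<beta>: "\<beta> > 2" and T: "T > 0"
  shows "(\<integral>\<^sup>+w. ennreal (1 / (1 + w powr (\<beta> / 2) / T)) * indicator {1..} w \<partial>lborel) = ennreal (Z1 \<beta> T)"
proof -
  define p where "p = \<beta> / (\<beta> - 2)"
  define q where "q = (\<beta> - 2) / 2"
  \<comment> \<open>These identities make the substitution work:
    \<open>(w powr (- q)) powr p\<close> and the factor \<open>w powr (- q - 1)\<close> from the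
    chain rule both equal w^(-\<beta>/2).\<close>
  have p: "p > 0" and q: "q > 0" and pq: "q * p = \<beta> / 2" and q\<beta>: "\<beta> / 2 = q + 1"
    using \<beta> by (auto simp: p_def q_def field_simps)
  define \<Psi> where "\<Psi> u = integral {0..u} (\<lambda>v. 1 / (1 + T * v powr p))" for u
  have nz: "1 + T * v powr p > 0" for v
    using T by (intro add_pos_nonneg) auto
  have cont: "continuous_on {0..u} (\<lambda>v. 1 / (1 + T * v powr p))" for u
    using p nz by (intro continuous_intros continuous_on_powr') (auto simp: less_imp_neq[THEN not_sym])
  have d\<Psi>: "(\<Psi> has_real_derivative 1 / (1 + T * u powr p)) (at u)" if "u > 0" for u
  proof -
    have "(\<Psi> has_real_derivative 1 / (1 + T * u powr p)) (at u within {0..u + 1})"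
      unfolding \<Psi>_def using that by (intro integral_has_real_derivative cont) auto
    then show ?thesis
      using that by (subst (asm) at_within_interior) auto
  qed
  have \<Psi>0: "(\<Psi> \<longlongrightarrow> 0) (at_right 0)"
  proof -
    have "continuous_on {0..1} \<Psi>"
      unfolding \<Psi>_def by (intro indefinite_integral_continuous_1 integrable_continuous_interval cont)
    then have "(\<Psi> \<longlongrightarrow> \<Psi> 0) (at 0 within {0..1})" by (auto simp: continuous_on)
    then show ?thesis by (simp add: at_within_Icc_at_right \<Psi>_def)
  qed
  define F where "F w = - (T / q * \<Psi> (w powr (- q)))" for w
  have "(\<integral>\<^sup>+w. ennreal (1 / (1 + w powr (\<beta> / 2) / T)) * indicator {1..} w \<partial>lborel) = ennreal (0 - F 1)"
  proof (rule nn_integral_FTC_atLeast)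
    fix w :: real assume w: "1 \<le> w"
    have a: "(w powr (- q)) powr p = inverse (w powr (\<beta> / 2))"
      unfolding powr_powr by (simp add: pq powr_minus)
    have b: "w powr (- q - 1) = inverse (w powr (\<beta> / 2))"
      unfolding q\<beta> powr_minus[symmetric] by simp
    have "T / q * (1 / (1 + T * (w powr (- q)) powr p) * (q * w powr (- q - 1))) = 1 / (1 + w powr (\<beta> / 2) / T)"
      unfolding a b using T q w by (simp add: field_simps)
    moreover have "(F has_real_derivative - (T / q * (1 / (1 + T * (w powr (- q)) powr p) * (- q * w powr (- q - 1))))) (at w)"
      unfolding F_def using w
      by (intro derivative_intros DERIV_cmult DERIV_chain2[OF d\<Psi>] DERIV_minus)
         (auto intro!: derivative_eq_intros)
    ultimately show "(F has_real_derivative 1 / (1 + w powr (\<beta> / 2) / T)) (at w)" by simp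
  next
    have "filterlim (\<lambda>w. w powr (- q)) (at_right 0) at_top"
      using q by (auto simp: filterlim_at intro!: tendsto_neg_powr filterlim_ident
          eventually_mono[OF eventually_gt_at_top[of 0]])
    from filterlim_compose[OF \<Psi>0 this] have "((\<lambda>w. \<Psi> (w powr (- q))) \<longlongrightarrow> 0) at_top" .
    from tendsto_mult_right[OF this, of "- (T / q)"] show "(F \<longlongrightarrow> 0) at_top"
      unfolding F_def by (simp add: mult.commute)
  qed (use T in auto)
  also have "0 - F 1 = Z1 \<beta> T"
    using T \<beta> by (simp add: F_def \<Psi>_def Z1_eq_integral p_def q_def)
  finally show ?thesis .
qed

lemma Z1_nonneg:
  assumes "\<beta> > 2" "T \<ge> 0" shows "Z1 \<beta> T \<ge> 0"
  unfolding Z1_eq_integral[OF assms] using assms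
  by (intro mult_nonneg_nonneg divide_nonneg_nonneg Henstock_Kurzweil_Integration.integral_nonneg integrable_continuous_interval continuous_intros continuous_on_powr') (auto simp: add_nonneg_eq_0_iff)

lemma nn_integral_scale_atLeast:
  assumes [measurable]: "f \<in> borel_measurable borel" and k: "k > 0"
  shows "(\<integral>\<^sup>+v. f v * indicator {k * a..} v \<partial>lborel) = ennreal k * (\<integral>\<^sup>+w. f (k * w) * indicator {a..} w \<partial>lborel)"
  using k by (subst nn_integral_real_affine[where c = k and t = 0])
    (auto intro!: arg_cong[where f = "\<lambda>x. _ * x"] nn_integral_cong split: split_indicator)

text \<open>For \<beta> > 2 this is the classical constant (2 pi / \<beta>) / sin (2 pi / \<beta>).
  The limit in \<open>Z2\<close> turns out to be this number times a power of
  \<open>exp t - 1\<close>.\<close>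

definition radial_const :: "real \<Rightarrow> real" where
  "radial_const \<beta> = enn2real (\<integral>\<^sup>+v. ennreal (1 / (1 + v powr (\<beta> / 2))) * indicator {0..} v \<partial>lborel)"

text \<open>Scaling by \<open>a\<close> moves the edge to 1 and produces the argument
  a^(-\<beta>/2). Up to its prefactor in \<open>t\<close>, the expression under the limit in
  \<open>Z2\<close> is thus a convergent integral cut off at \<open>a\<close>.\<close>

lemma nn_integral_radial_tail:
  assumes \<beta>: "\<beta> > 2" and a: "a > 0"
  shows "(\<integral>\<^sup>+v. ennreal (1 / (1 + v powr (\<beta> / 2))) * indicator {a..} v \<partial>lborel) = ennreal (a * Z1 \<beta> (a powr (- \<beta> / 2)))"
proof -
  have "(\<integral>\<^sup>+v. ennreal (1 / (1 + v powr (\<beta> / 2))) * indicator {a * 1..} v \<partial>lborel)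
     = ennreal a * (\<integral>\<^sup>+w. ennreal (1 / (1 + (a * w) powr (\<beta> / 2))) * indicator {1..} w \<partial>lborel)"
    by (rule nn_integral_scale_atLeast) (use a in auto)
  also have "\<dots> = ennreal a * (\<integral>\<^sup>+w. ennreal (1 / (1 + w powr (\<beta> / 2) / (a powr (- \<beta> / 2)))) * indicator {1..} w \<partial>lborel)"
    using a by (auto intro!: arg_cong[where f = "\<lambda>x. _ * x"] nn_integral_cong
      split: split_indicator simp: powr_mult powr_minus field_simps)
  also have "\<dots> = ennreal (a * Z1 \<beta> (a powr (- \<beta> / 2)))"
    using a \<beta> by (subst nn_integral_eq_Z1) (auto simp: ennreal_mult' Z1_nonneg)
  finally show ?thesis by simp
qed

text \<open>Split the half-line at \<open>a\<close>: on [0, a] the integrand is at most 1, so the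
  tail misses the whole integral by at most \<open>a\<close>. The upper bound at a = 1 also yields
  finiteness, which makes \<open>enn2real\<close> lossless.\<close>

lemma
  assumes \<beta>: "\<beta> > 2" 
  shows radial_const_nn_integral:
    "(\<integral>\<^sup>+v. ennreal (1 / (1 + v powr (\<beta> / 2))) * indicator {0..} v \<partial>lborel) = ennreal (radial_const \<beta>)"
  and radial_const_bounds: "a > 0 \<Longrightarrow> a * Z1 \<beta> (a powr (- \<beta> / 2)) \<le> radial_const \<beta>"
     "a > 0 \<Longrightarrow> radial_const \<beta> \<le> a + a * Z1 \<beta> (a powr (- \<beta> / 2))"
proof -
  let ?f = "\<lambda>v. ennreal (1 / (1 + v powr (\<beta> / 2)))"
  let ?I = "\<integral>\<^sup>+v. ?f v * indicator {0..} v \<partial>lborel"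
  have up: "?I \<le> ennreal (a + a * Z1 \<beta> (a powr (- \<beta> / 2)))" if a: "a > 0" for a
  proof -
    have "?I \<le> (\<integral>\<^sup>+v. indicator {0..a} v + ?f v * indicator {a..} v \<partial>lborel)"
      by (intro nn_integral_mono) (auto split: split_indicator simp: add_pos_nonneg)
    also have "\<dots> = ennreal a + ennreal (a * Z1 \<beta> (a powr (- \<beta> / 2)))"
      using a by (subst nn_integral_add) (auto simp: nn_integral_radial_tail[OF \<beta>])
    finally show ?thesis using a \<beta> by (simp add: ennreal_plus Z1_nonneg)
  qed
  show eq: "?I = ennreal (radial_const \<beta>)"
    using up[of 1] unfolding radial_const_def by (intro ennreal_enn2real[symmetric]) (auto simp: top.not_eq_extremum elim: order_le_less_trans)
  assume a: "a > 0"
  have "(\<integral>\<^sup>+v. ?f v * indicator {a..} v \<partial>lborel) \<le> ?I"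
    using a by (intro nn_integral_mono) (auto split: split_indicator)
  then show "a * Z1 \<beta> (a powr (- \<beta> / 2)) \<le> radial_const \<beta>"
    unfolding nn_integral_radial_tail[OF \<beta> a] eq by (subst (asm) ennreal_le_iff) (auto simp: radial_const_def)
  show "radial_const \<beta> \<le> a + a * Z1 \<beta> (a powr (- \<beta> / 2))"
    using up[OF a] a \<beta> unfolding eq by (subst (asm) ennreal_le_iff) (auto simp: Z1_nonneg)
qed

text \<open>Since a^((2-\<beta>)/2) = a a^(-\<beta>/2), the expression under the limit is a power of
  \<open>exp t - 1\<close> times \<open>a * Z1 \<beta> (a powr (- \<beta> / 2))\<close>, which
  \<open>radial_const_bounds\<close> squeezes to \<open>radial_const \<beta>\<close>.\<close>

lemma Z2_eq:
  assumes \<beta>: "\<beta> > 2"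
  shows "Z2 \<beta> t = (exp t - 1) powr (2 / \<beta>) * radial_const \<beta>"
proof -
  have "((\<lambda>a. a * Z1 \<beta> (a powr (- \<beta> / 2))) \<longlongrightarrow> radial_const \<beta>) (at_right 0)"
  proof (rule tendsto_sandwich)
    show "\<forall>\<^sub>F a in at_right 0. radial_const \<beta> - a \<le> a * Z1 \<beta> (a powr (- \<beta> / 2))"
      using radial_const_bounds(2)[OF \<beta>] by (auto simp: eventually_at_right_less eventually_at_filter algebra_simps)
    show "\<forall>\<^sub>F a in at_right 0. a * Z1 \<beta> (a powr (- \<beta> / 2)) \<le> radial_const \<beta>"
      using radial_const_bounds(1)[OF \<beta>] by (auto simp: eventually_at_filter)
    show "((\<lambda>a. radial_const \<beta> - a) \<longlongrightarrow> radial_const \<beta>) (at_right 0)"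
      by (auto intro!: tendsto_eq_intros)
  qed auto
  then have "((\<lambda>a. (exp t - 1) powr (2 / \<beta>) * (a * Z1 \<beta> (a powr (- \<beta> / 2)))) \<longlongrightarrow>
      (exp t - 1) powr (2 / \<beta>) * radial_const \<beta>) (at_right 0)"
    by (rule tendsto_mult_left)
  moreover have "\<forall>\<^sub>F a in at_right 0. (exp t - 1) powr (2 / \<beta>) * (a * Z1 \<beta> (a powr (- \<beta> / 2))) =
     (exp t - 1) powr (2 / \<beta>) * (2 * a powr ((2 - \<beta>) / 2) / (\<beta> - 2))
     * hyp2F1_real 1 (1 - 2 / \<beta>) (2 - 2 / \<beta>) (- (a powr (- \<beta> / 2)))"
  proof (rule eventually_at_right_less[THEN eventually_mono])
    fix a :: real assume a: "0 < a"
    have "a powr ((2 - \<beta>) / 2) = a * a powr (- \<beta> / 2)"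
      using a by (simp add: powr_mult_base diff_divide_distrib)
    then show "(exp t - 1) powr (2 / \<beta>) * (a * Z1 \<beta> (a powr (- \<beta> / 2))) =
     (exp t - 1) powr (2 / \<beta>) * (2 * a powr ((2 - \<beta>) / 2) / (\<beta> - 2))
     * hyp2F1_real 1 (1 - 2 / \<beta>) (2 - 2 / \<beta>) (- (a powr (- \<beta> / 2)))"
      by (simp add: Z1_def)
  qed
  ultimately show ?thesis
    unfolding Z2_def by (intro tendsto_Lim) (auto elim: Lim_transform_eventually)
qed

section \<open>Planar integrals of radial functions\<close>

lemma distr_norm_square:
  "distr lborel borel (\<lambda>z::real^2. (norm z)\<^sup>2) = density lborel (\<lambda>v. ennreal pi * indicator {0..} v)"
proof (rule measure_eqI_generator_eq[where E = "range (\<lambda>a::real. {..a})" and \<Omega> = UNIV and A = "\<lambda>n. {..real n}"])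
  \<comment> \<open>With the squared radius as coordinate the Jacobian is constant: the disc of
    squared radius \<open>a\<close> has area pi a. The half-lines {..a} form an intersection-stable
    generator, so these values determine the measure.\<close>
  have eq: "emeasure (distr lborel borel (\<lambda>z::real^2. (norm z)\<^sup>2)) {..a} = ennreal (pi * max 0 a)" for a
  proof -
    have "(\<lambda>z::real^2. (norm z)\<^sup>2) -` {..a} = (if a \<ge> 0 then cball 0 (sqrt a) else {})"
      using real_sqrt_le_iff[of "(norm _)\<^sup>2" a] by (auto simp: power2_eq_square intro: order_trans[OF zero_le_square])
    then show ?thesis
      using emeasure_cball[where 'a = "real^2", of "sqrt a" 0] by (subst emeasure_distr) (auto simp: unit_ball_vol_2)
  qed
  show "emeasure (distr lborel borel (\<lambda>z::real^2. (norm z)\<^sup>2)) X =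
      emeasure (density lborel (\<lambda>v. ennreal pi * indicator {0..} v)) X" if X: "X \<in> range (\<lambda>a::real. {..a})" for X
  proof -
    from X obtain a where [simp]: "X = {..a}" by auto
    have "emeasure (density lborel (\<lambda>v. ennreal pi * indicator {0..} v)) {..a} =
       (\<integral>\<^sup>+v. ennreal pi * indicator {0..a} v \<partial>lborel)"
      by (subst emeasure_density) (auto intro!: nn_integral_cong split: split_indicator)
    also have "\<dots> = ennreal (pi * max 0 a)"
      by (subst nn_integral_cmult_indicator) (auto simp: emeasure_lborel_Icc_eq ennreal_mult' max_def)
    finally show ?thesis using eq by simp
  qed
  show "emeasure (distr lborel borel (\<lambda>z::real^2. (norm z)\<^sup>2)) {..real n} \<noteq> \<infinity>" for n
    unfolding eq by simp
  show "Int_stable (range (\<lambda>a::real. {..a}))" by (auto simp: Int_stable_def)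
  show "sets (distr lborel borel (\<lambda>z::real^2. (norm z)\<^sup>2)) = sigma_sets UNIV (range (\<lambda>a::real. {..a}))"
    by (simp add: borel_eq_atMost sets_measure_of)
  show "sets (density lborel (\<lambda>v. ennreal pi * indicator {0..} v)) = sigma_sets UNIV (range (\<lambda>a::real. {..a}))"
    by (simp add: borel_eq_atMost sets_measure_of)
  show "(\<Union>n. {..real n}) = UNIV" using real_arch_simple by auto
qed auto

lemma nn_integral_radial:
  assumes [measurable]: "f \<in> borel_measurable borel"
  shows "(\<integral>\<^sup>+z. f ((norm (z::real^2))\<^sup>2) \<partial>lborel) = ennreal pi * (\<integral>\<^sup>+v. f v * indicator {0..} v \<partial>lborel)"
proof -
  have "(\<integral>\<^sup>+z. f ((norm (z::real^2))\<^sup>2) \<partial>lborel) = (\<integral>\<^sup>+v. f v \<partial>distr lborel borel (\<lambda>z::real^2. (norm z)\<^sup>2))"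
    by (subst nn_integral_distr) auto
  also have "\<dots> = (\<integral>\<^sup>+v. ennreal pi * (f v * indicator {0..} v) \<partial>lborel)"
    unfolding distr_norm_square by (subst nn_integral_density) (auto simp: ac_simps)
  finally show ?thesis by (simp add: nn_integral_cmult)
qed

text \<open>At \<open>z = 0\<close> the kernel is \<open>0\<close> instead of \<open>1\<close>, since \<open>0 powr (- \<beta>) = 0\<close>.\<close>

definition kernel :: "real \<Rightarrow> real \<Rightarrow> real^2 \<Rightarrow> real" where
  "kernel \<beta> c z = 1 - 1 / (1 + c * norm z powr (- \<beta>))"

lemma kernel_measurable[measurable]: "kernel \<beta> c \<in> borel_measurable borel"
  unfolding kernel_def[abs_def] by measurable

lemma kernel_bounds:
  assumes "c \<ge> 0" shows "0 \<le> kernel \<beta> c z" "kernel \<beta> c z \<le> 1"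
proof -
  have "1 + c * norm z powr (- \<beta>) \<ge> 1" using assms by simp
  then show "0 \<le> kernel \<beta> c z" "kernel \<beta> c z \<le> 1"
    unfolding kernel_def by (simp_all add: divide_le_eq)
qed

lemma interference_kernel_eq:
  assumes "c > 0" "z \<noteq> 0"
  shows "kernel \<beta> c z = 1 / (1 + ((norm z)\<^sup>2) powr (\<beta> / 2) / c)"
proof -
  have "((norm z)\<^sup>2) powr (\<beta> / 2) = norm z powr \<beta>"
    using assms by (simp add: powr_powr flip: powr_numeral)
  moreover have "norm z powr \<beta> > 0" using assms by simp
  then have "1 - 1 / (1 + c * inverse (norm z powr \<beta>)) = c / (norm z powr \<beta> + c)"
    and "1 / (1 + norm z powr \<beta> / c) = c / (norm z powr \<beta> + c)"
    using assms(1) by (simp_all add: divide_simps add_pos_pos less_imp_neq[THEN not_sym])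
  ultimately show ?thesis by (simp add: kernel_def powr_minus)
qed

lemma nn_integral_interference_kernel:
  assumes c: "c > 0" and r: "r \<ge> 0"
  shows "(\<integral>\<^sup>+z. ennreal (kernel \<beta> c z) * indicator {z::real^2. norm z \<ge> r} z \<partial>lborel) =
    ennreal pi * (\<integral>\<^sup>+v. ennreal (1 / (1 + v powr (\<beta> / 2) / c)) * indicator {r\<^sup>2..} v \<partial>lborel)"
proof -
  have "(\<integral>\<^sup>+z. ennreal (kernel \<beta> c z) * indicator {z::real^2. norm z \<ge> r} z \<partial>lborel) =
    (\<integral>\<^sup>+z. (\<lambda>v. ennreal (1 / (1 + v powr (\<beta> / 2) / c)) * indicator {r\<^sup>2..} v) ((norm (z::real^2))\<^sup>2) \<partial>lborel)"
  proof (rule nn_integral_cong_AE)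
    \<comment> \<open>For \<open>r = 0\<close> the two integrands differ at the origin, the kernel
      being 0 and the other side 1; a single point is null.\<close>
    have "AE z in lborel. z \<noteq> (0::real^2)" by (rule AE_lborel_singleton)
    then show "AE z in lborel. ennreal (kernel \<beta> c z) * indicator {z::real^2. norm z \<ge> r} z =
       ennreal (1 / (1 + ((norm z)\<^sup>2) powr (\<beta> / 2) / c)) * indicator {r\<^sup>2..} ((norm z)\<^sup>2)"
    proof eventually_elim
      case (elim z)
      then show ?case
        using r by (simp add: interference_kernel_eq[OF c] indicator_def abs_le_square_iff[symmetric])
    qed
  qed
  also have "\<dots> = ennreal pi * (\<integral>\<^sup>+v. ennreal (1 / (1 + v powr (\<beta> / 2) / c)) * indicator {r\<^sup>2..} v * indicator {0..} v \<partial>lborel)"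
    by (rule nn_integral_radial) auto
  also have "(\<integral>\<^sup>+v. ennreal (1 / (1 + v powr (\<beta> / 2) / c)) * indicator {r\<^sup>2..} v * indicator {0..} v \<partial>lborel) =
      (\<integral>\<^sup>+v. ennreal (1 / (1 + v powr (\<beta> / 2) / c)) * indicator {r\<^sup>2..} v \<partial>lborel)"
    by (intro nn_integral_cong) (auto split: split_indicator intro: order_trans[OF zero_le_power2])
  finally show ?thesis .
qed

text \<open>The scaling v = r^2 w moves the edge of the disc to 1 and leaves T = c r^(-\<beta>) as
  the only parameter of the integral.\<close>

lemma nn_integral_interference_kernel_outside:
  assumes \<beta>: "\<beta> > 2" and c: "c > 0" and r: "r > 0"
  shows "(\<integral>\<^sup>+z. ennreal (kernel \<beta> c z) * indicator {z::real^2. norm z \<ge> r} z \<partial>lborel) =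
    ennreal (pi * r\<^sup>2 * Z1 \<beta> (c * r powr (- \<beta>)))"
proof -
  have rb: "(r\<^sup>2) powr (\<beta> / 2) = r powr \<beta>" using r by (simp add: powr_powr flip: powr_numeral)
  have "(\<integral>\<^sup>+v. ennreal (1 / (1 + v powr (\<beta> / 2) / c)) * indicator {r\<^sup>2 * 1..} v \<partial>lborel) =
     ennreal (r\<^sup>2) * (\<integral>\<^sup>+w. ennreal (1 / (1 + (r\<^sup>2 * w) powr (\<beta> / 2) / c)) * indicator {1..} w \<partial>lborel)"
    using r by (intro nn_integral_scale_atLeast) auto
  also have "\<dots> = ennreal (r\<^sup>2) * (\<integral>\<^sup>+w. ennreal (1 / (1 + w powr (\<beta> / 2) / (c * r powr (- \<beta>)))) * indicator {1..} w \<partial>lborel)"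
    using r by (auto intro!: arg_cong[where f = "\<lambda>x. _ * x"] nn_integral_cong
      split: split_indicator simp: powr_mult rb powr_minus field_simps)
  also have "\<dots> = ennreal (r\<^sup>2) * ennreal (Z1 \<beta> (c * r powr (- \<beta>)))"
    using c r by (subst nn_integral_eq_Z1[OF \<beta>]) auto
  finally show ?thesis
    using c r \<beta> by (subst nn_integral_interference_kernel) (auto simp: ennreal_mult Z1_nonneg mult.assoc)
qed

text \<open>Without an excluded disc the scaling v = c^(2/\<beta>) w removes \<open>c\<close> from
  the integrand altogether; hence a pure power of \<open>c\<close> instead of
  \<open>Z1\<close>.\<close>

lemma nn_integral_interference_kernel_plane:
  assumes \<beta>: "\<beta> > 2" and c: "c > 0"
  shows "(\<integral>\<^sup>+z. ennreal (kernel \<beta> c z) \<partial>lborel) =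
    ennreal (pi * c powr (2 / \<beta>) * radial_const \<beta>)"
proof -
  have "(c powr (2 / \<beta>)) powr (\<beta> / 2) = c" using c \<beta> by (simp add: powr_powr)
  then have cb: "(c powr (2 / \<beta>) * w) powr (\<beta> / 2) / c = w powr (\<beta> / 2)" if "w \<ge> 0" for w
    using c that by (simp add: powr_mult)
  have "(\<integral>\<^sup>+v. ennreal (1 / (1 + v powr (\<beta> / 2) / c)) * indicator {c powr (2 / \<beta>) * 0..} v \<partial>lborel) =
     ennreal (c powr (2 / \<beta>)) * (\<integral>\<^sup>+w. ennreal (1 / (1 + (c powr (2 / \<beta>) * w) powr (\<beta> / 2) / c)) * indicator {0..} w \<partial>lborel)"
    using c by (intro nn_integral_scale_atLeast) auto
  also have "\<dots> = ennreal (c powr (2 / \<beta>)) * (\<integral>\<^sup>+w. ennreal (1 / (1 + w powr (\<beta> / 2))) * indicator {0..} w \<partial>lborel)"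
    by (auto intro!: arg_cong[where f = "\<lambda>x. _ * x"] nn_integral_cong split: split_indicator simp: cb)
  also have "\<dots> = ennreal (c powr (2 / \<beta>)) * ennreal (radial_const \<beta>)"
    by (simp add: radial_const_nn_integral[OF \<beta>])
  finally show ?thesis
    using nn_integral_interference_kernel[OF c, of 0 \<beta>] by (simp add: ennreal_mult radial_const_def mult.assoc)
qed

section \<open>The probability generating functional of a Poisson process\<close>

lemma exp_sums_scaled: "(\<lambda>n. (a * z) ^ n / fact n * exp (- a)) sums exp (- ((1 - z) * a))" for a z :: real
proof -
  have "(\<lambda>n. (a * z) ^ n / fact n) sums exp (a * z)"
    using exp_converges[of "a * z"] by (simp add: divide_inverse mult.commute)
  from sums_mult2[OF this, of "exp (- a)"] show ?thesis
    by (simp add: exp_add[symmetric] algebra_simps)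
qed

lemma (in prob_space) expectation_power_poisson:
  fixes N :: "'a \<Rightarrow> nat"
  assumes N[measurable]: "random_variable (count_space UNIV) N"
    and p: "\<And>n. prob {\<omega> \<in> space M. N \<omega> = n} = a ^ n / fact n * exp (- a)"
    and a: "a \<ge> 0" and z: "z \<ge> (0::real)"
  shows "expectation (\<lambda>\<omega>. z ^ N \<omega>) = exp (- ((1 - z) * a))"
proof -
  let ?p = "\<lambda>n. a ^ n / fact n * exp (- a)"
  have distr: "distr M (count_space UNIV) N = density (count_space UNIV) (\<lambda>n. ennreal (?p n))"
  proof (rule measure_eqI_countable[where A = UNIV])
    fix n
    have "emeasure (distr M (count_space UNIV) N) {n} = emeasure M {\<omega> \<in> space M. N \<omega> = n}"
      by (subst emeasure_distr) (auto intro!: arg_cong[where f = "emeasure M"])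
    also have "\<dots> = ennreal (?p n)" by (simp add: emeasure_eq_measure p)
    finally show "emeasure (distr M (count_space UNIV) N) {n} =
        emeasure (density (count_space UNIV) (\<lambda>n. ennreal (?p n))) {n}"
      by (simp add: emeasure_density nn_integral_count_space_indicator[symmetric] nn_integral_count_space_finite)
  qed auto
  have eq: "?p n * z ^ n = (a * z) ^ n / fact n * exp (- a)" for n
    by (simp add: power_mult_distrib)
  have "integrable (count_space UNIV) (\<lambda>n. ?p n * z ^ n)"
    unfolding integrable_count_space_nat_iff eq
    using exp_sums_scaled[of a z, THEN sums_summable] a z by (simp add: abs_mult)
  moreover have "expectation (\<lambda>\<omega>. z ^ N \<omega>) = (\<integral>n. z ^ n \<partial>distr M (count_space UNIV) N)"
    by (subst integral_distr) auto
  then have "expectation (\<lambda>\<omega>. z ^ N \<omega>) = (\<integral>n. ?p n * z ^ n \<partial>count_space UNIV)"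
    unfolding distr using a by (subst (asm) integral_density) auto
  ultimately have "expectation (\<lambda>\<omega>. z ^ N \<omega>) = (\<Sum>n. ?p n * z ^ n)"
    by (simp add: integral_count_space_nat)
  then show ?thesis unfolding eq using exp_sums_scaled[of a z] by (simp add: sums_iff)
qed

lemma (in prob_space) poisson_processD:
  assumes "poisson_process M \<mu> A Y"
  shows "\<And>k. random_variable borel (Y k)"
    and "\<And>B. B \<in> sets borel \<Longrightarrow> bounded B \<Longrightarrow> AE \<omega> in M. finite {k. Y k \<omega> \<in> B}"
    and "\<And>B n. B \<in> sets borel \<Longrightarrow> bounded B \<Longrightarrow> prob {\<omega> \<in> space M. point_count Y B \<omega> = n} =
             (\<mu> * measure lborel (B \<inter> A)) ^ n / fact n * exp (- (\<mu> * measure lborel (B \<inter> A)))"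
    and "\<And>(J :: nat set) B. finite J \<Longrightarrow> disjoint_family_on B J \<Longrightarrow>
        (\<And>j. j \<in> J \<Longrightarrow> B j \<in> sets borel) \<Longrightarrow> (\<And>j. j \<in> J \<Longrightarrow> bounded (B j)) \<Longrightarrow>
        indep_vars (\<lambda>_. count_space UNIV) (\<lambda>j. point_count Y (B j)) J"
    and "\<And>B. B \<in> sets borel \<Longrightarrow> bounded B \<Longrightarrow> random_variable (count_space UNIV) (point_count Y B)"
proof -
  note Y = assms[unfolded poisson_process_def]
  note Y2 = Y[THEN conjunct2, THEN conjunct1, rule_format]
  show "random_variable borel (Y k)" for k
    using Y[THEN conjunct1] by simp
  show "AE \<omega> in M. finite {k. Y k \<omega> \<in> B}" if "B \<in> sets borel" "bounded B" for B
    by (rule Y2[OF that, THEN conjunct1])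
  show "prob {\<omega> \<in> space M. point_count Y B \<omega> = n} =
      (\<mu> * measure lborel (B \<inter> A)) ^ n / fact n * exp (- (\<mu> * measure lborel (B \<inter> A)))"
    if "B \<in> sets borel" "bounded B" for B n
    by (rule Y2[OF that, THEN conjunct2, rule_format])
  show 4: "indep_vars (\<lambda>_. count_space UNIV) (\<lambda>j. point_count Y (B j)) J"
    if "finite J" "disjoint_family_on B J" "\<And>j. j \<in> J \<Longrightarrow> B j \<in> sets borel" "\<And>j. j \<in> J \<Longrightarrow> bounded (B j)"
    for J :: "nat set" and B
    by (rule Y[THEN conjunct2, THEN conjunct2, rule_format, OF that(1,2)]) (use that(3,4) in simp)
  show "random_variable (count_space UNIV) (point_count Y B)" if "B \<in> sets borel" "bounded B" for B
    \<comment> \<open>Independence of a one-member family contains the measurability of its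
      member.\<close>
    using 4[of "{0}" "\<lambda>_. B"] that by (simp add: disjoint_family_on_def indep_vars_def2)
qed

text \<open>For \<open>q\<close> of finite range and only finitely many points in its support, this
  is the product of \<open>1 - q y\<close> over all points \<open>y\<close>, grouped by the value of
  \<open>q\<close>. Grouping expresses it through counts, the quantities whose law is prescribed.
  The value 0 contributes a factor 1 and is left out because its level set is unbounded when
  \<open>q\<close> has bounded support.\<close>

definition process_weight :: "('a \<Rightarrow> real) \<Rightarrow> (nat \<Rightarrow> 'w \<Rightarrow> 'a) \<Rightarrow> 'w \<Rightarrow> real" where
  "process_weight q Y \<omega> = (\<Prod>c\<in>range q - {0}. (1 - c) ^ point_count Y (q -` {c}) \<omega>)"

text \<open>Once the partial product has passed the finitely many points in the support of
  \<open>q\<close>, all further factors are 1 and the order of enumeration no longer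
  matters.\<close>

lemma process_weight_eq_prod:
  assumes q: "finite (range q)" and K: "finite {k. q (Y k \<omega>) \<noteq> 0}"
  shows "\<forall>\<^sub>F n in sequentially. (\<Prod>k<n. 1 - q (Y k \<omega>)) = process_weight q Y \<omega>"
proof -
  define K' where "K' = {k. q (Y k \<omega>) \<noteq> 0}"
  have K': "finite K'" using K by (simp add: K'_def)
  obtain n0 where n0: "\<And>k. k \<in> K' \<Longrightarrow> k < n0" using K' by (metis finite_nat_set_iff_bounded)
  have "(\<Prod>k<n. 1 - q (Y k \<omega>)) = process_weight q Y \<omega>" if "n \<ge> n0" for n
  proof -
    have "(\<Prod>k<n. 1 - q (Y k \<omega>)) = (\<Prod>k\<in>K'. 1 - q (Y k \<omega>))"
      using n0 that by (intro prod.mono_neutral_right) (auto simp: K'_def intro: less_le_trans)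
    also have "\<dots> = (\<Prod>c\<in>range q - {0}. \<Prod>k | k \<in> K' \<and> q (Y k \<omega>) = c. 1 - q (Y k \<omega>))"
      using q K' by (intro prod.group[symmetric]) (auto simp: K'_def)
    also have "\<dots> = process_weight q Y \<omega>"
      unfolding process_weight_def point_count_def
    proof (rule prod.cong[OF refl])
      fix c assume c: "c \<in> range q - {0}"
      have "{k. k \<in> K' \<and> q (Y k \<omega>) = c} = {k. Y k \<omega> \<in> q -` {c}}" using c by (auto simp: K'_def)
      moreover have "(\<Prod>k | k \<in> K' \<and> q (Y k \<omega>) = c. 1 - q (Y k \<omega>)) = (\<Prod>k | k \<in> K' \<and> q (Y k \<omega>) = c. 1 - c)"
        by (rule prod.cong) auto
      ultimately show "(\<Prod>k | k \<in> K' \<and> q (Y k \<omega>) = c. 1 - q (Y k \<omega>)) = (1 - c) ^ card {k. Y k \<omega> \<in> q -` {c}}"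
        by simp
    qed
    finally show ?thesis .
  qed
  then show ?thesis by (auto simp: eventually_sequentially)
qed

text \<open>The level sets of the nonzero values are disjoint and bounded, so their counts are
  independent Poisson variables. The product of the generating functions is an exponential whose
  exponent sums the values of \<open>q\<close> against the volumes of the level sets: the integral
  of a simple function.\<close>

lemma (in prob_space) expectation_process_weight:
  fixes q :: "'b::euclidean_space \<Rightarrow> real"
  assumes Y: "poisson_process M \<mu> A Y" and \<mu>: "\<mu> \<ge> 0" and A: "A \<in> sets borel"
    and q: "finite (range q)" "q \<in> borel_measurable borel" "\<And>y. q y \<le> 1"
    and bdd: "bounded {y. q y \<noteq> 0}"
  shows "expectation (process_weight q Y) = exp (- (\<mu> * (\<integral>y. q y * indicator A y \<partial>lborel)))"
proof -
  define C where "C = range q - {0}"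
  have C: "finite C" using q by (simp add: C_def)
  \<comment> \<open>The values of \<open>q\<close> are numbered because
    \<open>poisson_process\<close> states independence for families indexed by natural
    numbers.\<close>
  obtain f where f: "bij_betw f {0..<card C} C" using ex_bij_betw_nat_finite[OF C] by blast
  define B where "B c = q -` {c}" for c
  have Bb: "B c \<in> sets borel" for c
    unfolding B_def using measurable_sets_borel[OF q(2)] by auto
  have Bbd: "bounded (B c)" if "c \<in> C" for c
    using that by (intro bounded_subset[OF bdd]) (auto simp: B_def C_def)
  have fC: "f j \<in> C" if "j < card C" for j using f that by (auto simp: bij_betw_def)
  have "indep_vars (\<lambda>_. count_space UNIV) (\<lambda>j. point_count Y (B (f j))) {0..<card C}"
  proof (rule poisson_processD(4)[OF Y])
    show "disjoint_family_on (\<lambda>j. B (f j)) {0..<card C}"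
      using f by (auto simp: disjoint_family_on_def B_def bij_betw_def inj_on_def)
  qed (use Bb Bbd fC in auto)
  then have ind: "indep_vars (\<lambda>_. borel) (\<lambda>j \<omega>. (1 - f j) ^ point_count Y (B (f j)) \<omega>) {0..<card C}"
    by (rule indep_vars_compose2) auto
  have c1: "c \<le> 1" if "c \<in> C" for c using that q(3) by (auto simp: C_def)
  have int: "integrable M (\<lambda>\<omega>. (1 - f j) ^ point_count Y (B (f j)) \<omega>)" if "j < card C" for j
  proof (rule ccontr)
    assume *: "\<not> integrable M (\<lambda>\<omega>. (1 - f j) ^ point_count Y (B (f j)) \<omega>)"
    have "expectation (\<lambda>\<omega>. (1 - f j) ^ point_count Y (B (f j)) \<omega>) =
       exp (- ((1 - (1 - f j)) * (\<mu> * measure lborel (B (f j) \<inter> A))))"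
      using c1[OF fC[OF that]] \<mu> by (intro expectation_power_poisson poisson_processD(3,5)[OF Y] Bb Bbd fC that) auto
    with not_integrable_integral_eq[OF *] show False by simp
  qed
  have "expectation (process_weight q Y) = expectation (\<lambda>\<omega>. \<Prod>j\<in>{0..<card C}. (1 - f j) ^ point_count Y (B (f j)) \<omega>)"
    unfolding process_weight_def[abs_def] C_def[symmetric] B_def[symmetric]
    by (subst prod.reindex_bij_betw[OF f]) simp
  also have "\<dots> = (\<Prod>j\<in>{0..<card C}. expectation (\<lambda>\<omega>. (1 - f j) ^ point_count Y (B (f j)) \<omega>))"
    using int by (intro indep_vars_lebesgue_integral ind) auto
  also have "\<dots> = (\<Prod>j\<in>{0..<card C}. exp (- (\<mu> * (f j * measure lborel (B (f j) \<inter> A)))))"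
  proof (rule prod.cong[OF refl])
    fix j assume j: "j \<in> {0..<card C}"
    have "expectation (\<lambda>\<omega>. (1 - f j) ^ point_count Y (B (f j)) \<omega>) =
       exp (- ((1 - (1 - f j)) * (\<mu> * measure lborel (B (f j) \<inter> A))))"
      using c1[OF fC] \<mu> j by (intro expectation_power_poisson poisson_processD(3,5)[OF Y] Bb Bbd fC) auto
    then show "expectation (\<lambda>\<omega>. (1 - f j) ^ point_count Y (B (f j)) \<omega>) = exp (- (\<mu> * (f j * measure lborel (B (f j) \<inter> A))))"
      by (simp add: mult.left_commute)
  qed
  also have "\<dots> = (\<Prod>c\<in>C. exp (- (\<mu> * (c * measure lborel (B c \<inter> A)))))"
    by (rule prod.reindex_bij_betw[OF f])
  also have "\<dots> = exp (- (\<mu> * (\<Sum>c\<in>C. c * measure lborel (B c \<inter> A))))"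
    by (simp add: exp_sum[OF C] sum_distrib_left sum_negf[symmetric])
  also have "(\<Sum>c\<in>C. c * measure lborel (B c \<inter> A)) = (\<integral>y. (\<Sum>c\<in>C. c * indicator (B c \<inter> A) y) \<partial>lborel)"
  proof -
    have "emeasure lborel (B c \<inter> A) < \<infinity>" if "c \<in> C" for c
      by (intro emeasure_bounded_finite bounded_subset[OF Bbd[OF that]]) auto
    then show ?thesis
      using Bb A by (subst Bochner_Integration.integral_sum) auto
  qed
  also have "(\<lambda>y. \<Sum>c\<in>C. c * indicator (B c \<inter> A) y) = (\<lambda>y. q y * indicator A y)"
  proof
    fix y
    have "(\<Sum>c\<in>C. c * indicator (B c \<inter> A) y) = (\<Sum>c\<in>C. if q y = c then q y * indicator A y else 0)"
      by (intro sum.cong) (auto simp: B_def indicator_def)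
    also have "\<dots> = q y * indicator A y" using C by (auto simp: C_def)
    finally show "(\<Sum>c\<in>C. c * indicator (B c \<inter> A) y) = q y * indicator A y" .
  qed
  finally show ?thesis .
qed

text \<open>Measurability with respect to the counts alone is what links the weights to the events
  for which independence of the tiers is assumed. The level sets that occur are bounded, as the
  generating counts require, since the value 0 is omitted.\<close>

lemma (in prob_space) process_weight_measurable:
  fixes q :: "'b::euclidean_space \<Rightarrow> real"
  assumes q: "q \<in> borel_measurable borel" "bounded {y. q y \<noteq> 0}"
  shows "process_weight q Y \<in> borel_measurable (sigma (space M) (\<Union>B\<in>{B \<in> sets borel. bounded B}.
      {point_count Y B -` C \<inter> space M | C. C \<in> sets borel}))" (is "_ \<in> borel_measurable ?S")
proof -
  have "point_count Y B \<in> ?S \<rightarrow>\<^sub>M borel" if "B \<in> sets borel" "bounded B" for B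
    by (rule measurableI) (use that in \<open>auto intro!: sigma_sets.Basic simp: sets_measure_of space_measure_of_conv\<close>)
  then have N: "point_count Y B \<in> ?S \<rightarrow>\<^sub>M count_space UNIV" if "B \<in> sets borel" "bounded B" for B
    using that measurable_cong_sets[OF refl sets_borel_eq_count_space] by blast
  have B: "q -` {c} \<in> sets borel" for c using measurable_sets_borel[OF q(1)] by auto
  have "bounded (q -` {c})" if "c \<noteq> 0" for c
    using that by (intro bounded_subset[OF q(2)]) auto
  then have "(\<lambda>\<omega>. (1 - c) ^ point_count Y (q -` {c}) \<omega>) \<in> borel_measurable ?S" if "c \<noteq> 0" for c
    using that by (intro measurable_compose[OF N[OF B], where g = "\<lambda>n. (1 - c) ^ n"]) auto
  then show ?thesis unfolding process_weight_def[abs_def] by (intro borel_measurable_prod) auto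
qed

lemma (in prob_space) indep_process_weights:
  fixes q :: "'i \<Rightarrow> 'b::euclidean_space \<Rightarrow> real"
  assumes ind: "indep_sets (\<lambda>m. process_events M (Y m)) I"
    and q: "\<And>m. m \<in> I \<Longrightarrow> q m \<in> borel_measurable borel" "\<And>m. m \<in> I \<Longrightarrow> bounded {y. q m y \<noteq> 0}"
  shows "indep_vars (\<lambda>_. borel) (\<lambda>m. process_weight (q m) (Y m)) I"
proof -
  define G where "G m = (\<Union>B\<in>{B \<in> sets borel. bounded B}.
      {point_count (Y m) B -` C \<inter> space M | C. C \<in> sets borel})" for m
  have G: "G m \<subseteq> Pow (space M)" for m by (auto simp: G_def)
  have pe: "process_events M (Y m) = sigma_sets (space M) (G m)" for m
    by (simp add: process_events_def generated_events_def G_def)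
  have W: "process_weight (q m) (Y m) \<in> borel_measurable (sigma (space M) (G m))" if "m \<in> I" for m
    unfolding G_def using that q by (intro process_weight_measurable) auto
  have sub: "{process_weight (q m) (Y m) -` C \<inter> space M | C. C \<in> sets borel} \<subseteq> process_events M (Y m)"
    if "m \<in> I" for m
    using measurable_sets[OF W[OF that]] G by (auto simp: pe space_measure_of_conv)
  have ev: "process_events M (Y m) \<subseteq> events" if "m \<in> I" for m
    using ind that by (auto simp: indep_sets_def)
  have "random_variable borel (process_weight (q m) (Y m))" if "m \<in> I" for m
    using sub[OF that] ev[OF that] by (auto intro!: measurableI)
  then show ?thesis unfolding indep_vars_def2 by (intro conjI ballI indep_sets_mono_sets[OF ind sub]) auto
qed

text \<open>Almost surely the partial products are eventually constant, and they lie in [0, 1].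
  Dominated convergence reduces the limit to the weights, whose expectations factorise by
  independence.\<close>

lemma (in prob_space) poisson_pgfl_simple:
  fixes q :: "'i \<Rightarrow> 'b::euclidean_space \<Rightarrow> real"
  assumes I: "finite I"
    and Y: "\<And>m. m \<in> I \<Longrightarrow> poisson_process M (\<mu> m) (A m) (Y m)"
    and ind: "indep_sets (\<lambda>m. process_events M (Y m)) I"
    and \<mu>: "\<And>m. m \<in> I \<Longrightarrow> \<mu> m \<ge> 0" and A: "\<And>m. m \<in> I \<Longrightarrow> A m \<in> sets borel"
    and q: "\<And>m. m \<in> I \<Longrightarrow> finite (range (q m))" "\<And>m. m \<in> I \<Longrightarrow> q m \<in> borel_measurable borel"
      "\<And>m y. m \<in> I \<Longrightarrow> 0 \<le> q m y" "\<And>m y. m \<in> I \<Longrightarrow> q m y \<le> 1"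
      "\<And>m. m \<in> I \<Longrightarrow> bounded {y. q m y \<noteq> 0}"
  shows "(\<lambda>n. expectation (\<lambda>\<omega>. \<Prod>m\<in>I. \<Prod>k<n. 1 - q m (Y m k \<omega>))) \<longlonglongrightarrow>
    exp (- (\<Sum>m\<in>I. \<mu> m * (\<integral>y. q m y * indicator (A m) y \<partial>lborel)))"
proof -
  note [measurable] = q(2) poisson_processD(1)[OF Y]
  have rv: "indep_vars (\<lambda>_. borel) (\<lambda>m. process_weight (q m) (Y m)) I"
    using ind q by (intro indep_process_weights) auto
  then have W[measurable]: "random_variable borel (process_weight (q m) (Y m))" if "m \<in> I" for m
    using that by (auto simp: indep_vars_def2)
  have W01: "0 \<le> process_weight (q m) (Y m) \<omega>" "process_weight (q m) (Y m) \<omega> \<le> 1" if "m \<in> I" for m \<omega>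
    unfolding process_weight_def using q(3,4)[OF that]
    by (auto intro!: prod_nonneg prod_le_1 power_le_one)
  have "(\<lambda>n. expectation (\<lambda>\<omega>. \<Prod>m\<in>I. \<Prod>k<n. 1 - q m (Y m k \<omega>))) \<longlonglongrightarrow>
      expectation (\<lambda>\<omega>. \<Prod>m\<in>I. process_weight (q m) (Y m) \<omega>)"
  proof (rule integral_dominated_convergence[where w = "\<lambda>_. 1"])
    have "AE \<omega> in M. \<forall>m\<in>I. finite {k. q m (Y m k \<omega>) \<noteq> 0}"
    proof (rule AE_finite_allI[OF I])
      fix m assume m: "m \<in> I"
      have "{y. q m y \<noteq> 0} \<in> sets borel" using q(2)[OF m] by measurable
      from poisson_processD(2)[OF Y[OF m] this q(5)[OF m]]
      show "AE \<omega> in M. finite {k. q m (Y m k \<omega>) \<noteq> 0}" by simp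
    qed
    then show "AE \<omega> in M. (\<lambda>n. \<Prod>m\<in>I. \<Prod>k<n. 1 - q m (Y m k \<omega>)) \<longlonglongrightarrow> (\<Prod>m\<in>I. process_weight (q m) (Y m) \<omega>)"
      by eventually_elim (intro tendsto_prod tendsto_eventually process_weight_eq_prod q(1), auto)
    show "AE \<omega> in M. norm (\<Prod>m\<in>I. \<Prod>k<n. 1 - q m (Y m k \<omega>)) \<le> 1" for n
    proof (rule AE_I2)
      fix \<omega>
      have "0 \<le> (\<Prod>m\<in>I. \<Prod>k<n. 1 - q m (Y m k \<omega>))" "(\<Prod>m\<in>I. \<Prod>k<n. 1 - q m (Y m k \<omega>)) \<le> 1"
        using q(3,4) by (auto intro!: prod_nonneg prod_le_1)
      then show "norm (\<Prod>m\<in>I. \<Prod>k<n. 1 - q m (Y m k \<omega>)) \<le> 1" by simp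
    qed
  qed auto
  also have "expectation (\<lambda>\<omega>. \<Prod>m\<in>I. process_weight (q m) (Y m) \<omega>) = (\<Prod>m\<in>I. expectation (process_weight (q m) (Y m)))"
    using W W01 by (intro indep_vars_lebesgue_integral I rv integrable_const_bound[where B = 1]) auto
  also have "\<dots> = (\<Prod>m\<in>I. exp (- (\<mu> m * (\<integral>y. q m y * indicator (A m) y \<partial>lborel))))"
    using q A Y \<mu> by (intro prod.cong refl expectation_process_weight) auto
  finally show ?thesis by (simp add: exp_sum[OF I] sum_negf[symmetric])
qed

text \<open>Cutting the usual simple approximations off outside the ball of radius \<open>j\<close>
  gives them bounded support, so that counts of their level sets are available; every point lies in
  all but finitely many of these balls.\<close>

lemma real_simple_function_approximation:
  fixes q :: "'b::euclidean_space \<Rightarrow> real"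
  assumes "q \<in> borel_measurable borel" "\<And>y. 0 \<le> q y"
  obtains u where "\<And>j. finite (range (u j))" "\<And>j. u j \<in> borel_measurable borel"
    "\<And>j y. 0 \<le> u j y" "\<And>j y. u j y \<le> q y" "\<And>y. (\<lambda>j. u j y) \<longlonglongrightarrow> q y" "\<And>j. bounded {y. u j y \<noteq> 0}"
proof -
  obtain f where f: "incseq f" "\<And>i. simple_function borel (f i)" "\<And>x. bdd_above (range (\<lambda>i. f i x))"
    "\<And>i x. 0 \<le> f i x" "q = (SUP i. f i)"
    using borel_measurable_implies_simple_function_sequence_real[OF assms] by blast
  have qx: "q x = (SUP i. f i x)" for x using f(5) by (simp add: image_image)
  have le: "f i x \<le> q x" for i x unfolding qx by (rule cSUP_upper) (use f(3) in auto)
  have lim: "(\<lambda>i. f i x) \<longlonglongrightarrow> q x" for x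
    unfolding qx using f(1,3) by (intro LIMSEQ_incseq_SUP) (auto simp: incseq_def le_fun_def)
  show thesis
  proof (rule that[of "\<lambda>j y. f j y * indicator (ball 0 (real j)) y"])
    show "finite (range (\<lambda>y. f j y * indicator (ball 0 (real j)) y))" for j
    proof (rule finite_subset)
      show "range (\<lambda>y. f j y * indicator (ball 0 (real j)) y) \<subseteq> insert 0 (range (f j))"
        by (auto simp: indicator_def)
      show "finite (insert 0 (range (f j)))" using simple_functionD(1)[OF f(2)[of j]] by simp
    qed
    show "(\<lambda>y. f j y * indicator (ball 0 (real j)) y) \<in> borel_measurable borel" for j
      by (intro borel_measurable_times borel_measurable_simple_function[OF f(2)] borel_measurable_indicator) auto
    show "(\<lambda>j. f j y * indicator (ball 0 (real j)) y) \<longlonglongrightarrow> q y" for y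
    proof (rule Lim_transform_eventually[OF lim])
      obtain n where n: "norm y < real n" using reals_Archimedean2 by blast
      show "\<forall>\<^sub>F j in sequentially. f j y = f j y * indicator (ball 0 (real j)) y"
        using eventually_ge_at_top[of n] by eventually_elim (use n in \<open>auto simp: indicator_def\<close>)
    qed
    show "bounded {y. f j y * indicator (ball 0 (real j)) y \<noteq> 0}" for j
      by (rule bounded_subset[OF bounded_ball[of 0 "real j"]]) (auto simp: indicator_def split: if_splits)
  qed (use f(4) le assms in \<open>auto simp: indicator_def\<close>)
qed

text \<open>Two limits are exchanged: in the number \<open>n\<close> of factors and in the index
  \<open>j\<close> of the simple approximation from below. The expectations of \<open>b j n\<close>
  decrease in \<open>n\<close> to \<open>L j\<close>, so
  \<open>L j \<le> expectation (b j n)\<close>, and j -> \<infinity> gives the lower bound for every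
  \<open>n\<close>. Conversely \<open>a n \<le> b j n\<close>, whose expectations come arbitrarily
  close to \<open>L j\<close>, and \<open>L j\<close> is close to the claimed limit for large
  \<open>j\<close>.\<close>

lemma (in prob_space) poisson_pgfl:
  fixes q :: "'i \<Rightarrow> 'b::euclidean_space \<Rightarrow> real"
  assumes I: "finite I"
    and Y: "\<And>m. m \<in> I \<Longrightarrow> poisson_process M (\<mu> m) (A m) (Y m)"
    and ind: "indep_sets (\<lambda>m. process_events M (Y m)) I"
    and \<mu>: "\<And>m. m \<in> I \<Longrightarrow> \<mu> m \<ge> 0" and A: "\<And>m. m \<in> I \<Longrightarrow> A m \<in> sets borel"
    and q: "\<And>m. m \<in> I \<Longrightarrow> q m \<in> borel_measurable borel"
      "\<And>m y. m \<in> I \<Longrightarrow> 0 \<le> q m y" "\<And>m y. m \<in> I \<Longrightarrow> q m y \<le> 1"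
    and int: "\<And>m. m \<in> I \<Longrightarrow> integrable lborel (\<lambda>y. q m y * indicator (A m) y)"
  shows "(\<lambda>n. expectation (\<lambda>\<omega>. \<Prod>m\<in>I. \<Prod>k<n. 1 - q m (Y m k \<omega>))) \<longlonglongrightarrow>
    exp (- (\<Sum>m\<in>I. \<mu> m * (\<integral>y. q m y * indicator (A m) y \<partial>lborel)))" (is "_ \<longlonglongrightarrow> ?L")
proof -
  note [measurable] = q(1) poisson_processD(1)[OF Y] A
  have "\<forall>m\<in>I. \<exists>u. (\<forall>j. finite (range (u j))) \<and> (\<forall>j. u j \<in> borel_measurable borel) \<and>
      (\<forall>j y. 0 \<le> u j y) \<and> (\<forall>j y. u j y \<le> q m y) \<and> (\<forall>y. (\<lambda>j. u j y) \<longlonglongrightarrow> q m y) \<and> (\<forall>j. bounded {y. u j y \<noteq> 0})"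
    using real_simple_function_approximation[OF q(1,2)] by metis
  from bchoice[OF this] obtain u where U: "\<forall>m\<in>I. (\<forall>j. finite (range (u m j))) \<and> (\<forall>j. u m j \<in> borel_measurable borel) \<and>
      (\<forall>j y. 0 \<le> u m j y) \<and> (\<forall>j y. u m j y \<le> q m y) \<and> (\<forall>y. (\<lambda>j. u m j y) \<longlonglongrightarrow> q m y) \<and> (\<forall>j. bounded {y. u m j y \<noteq> 0})"
    by blast
  have u: "\<And>m j. m \<in> I \<Longrightarrow> finite (range (u m j))"
    and [measurable]: "\<And>m j. m \<in> I \<Longrightarrow> u m j \<in> borel_measurable borel"
    and u0: "\<And>m j y. m \<in> I \<Longrightarrow> 0 \<le> u m j y" and uq: "\<And>m j y. m \<in> I \<Longrightarrow> u m j y \<le> q m y"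
    and ulim: "\<And>m y. m \<in> I \<Longrightarrow> (\<lambda>j. u m j y) \<longlonglongrightarrow> q m y" and ubd: "\<And>m j. m \<in> I \<Longrightarrow> bounded {y. u m j y \<noteq> 0}"
    using U by blast+
  have u1: "u m j y \<le> 1" if "m \<in> I" for m j y using uq[OF that] q(3)[OF that] order_trans by blast
  define a where "a n \<omega> = (\<Prod>m\<in>I. \<Prod>k<n. 1 - q m (Y m k \<omega>))" for n \<omega>
  define b where "b j n \<omega> = (\<Prod>m\<in>I. \<Prod>k<n. 1 - u m j (Y m k \<omega>))" for j n \<omega>
  define L where "L j = exp (- (\<Sum>m\<in>I. \<mu> m * (\<integral>y. u m j y * indicator (A m) y \<partial>lborel)))" for j
  have [measurable]: "random_variable borel (a n)" "random_variable borel (b j n)" for j n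
    unfolding a_def[abs_def] b_def[abs_def] by measurable
  have a01: "0 \<le> a n \<omega>" "a n \<omega> \<le> 1" for n \<omega>
    unfolding a_def using q(2,3) by (auto intro!: prod_nonneg prod_le_1)
  have b01: "0 \<le> b j n \<omega>" "b j n \<omega> \<le> 1" for j n \<omega>
    unfolding b_def using u0 u1 by (auto intro!: prod_nonneg prod_le_1)
  have ia: "integrable M (a n)" and ib: "integrable M (b j n)" for j n
    using a01 b01 by (auto intro!: integrable_const_bound[where B = 1])
  have ab: "a n \<omega> \<le> b j n \<omega>" for j n \<omega>
    unfolding a_def b_def using q uq by (auto intro!: prod_mono prod_nonneg)
  have bdec: "b j (Suc n) \<omega> \<le> b j n \<omega>" for j n \<omega>
    unfolding b_def using u0 u1 by (auto intro!: prod_mono prod_nonneg mult_left_le mult_nonneg_nonneg)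
  have blim: "(\<lambda>n. expectation (b j n)) \<longlonglongrightarrow> L j" for j
    unfolding b_def[abs_def] L_def using u u0 u1 ubd
    by (intro poisson_pgfl_simple I Y ind \<mu> A) auto
  have "decseq (\<lambda>n. expectation (b j n))" for j
    by (intro decseq_SucI integral_mono ib bdec)
  then have Lb: "L j \<le> expectation (b j n)" for j n
    using decseq_ge[OF _ blim] by blast
  have alim: "(\<lambda>j. expectation (b j n)) \<longlonglongrightarrow> expectation (a n)" for n
  proof (rule integral_dominated_convergence[where w = "\<lambda>_. 1"])
    show "AE \<omega> in M. (\<lambda>j. b j n \<omega>) \<longlonglongrightarrow> a n \<omega>"
      unfolding a_def b_def by (intro AE_I2 tendsto_prod tendsto_diff tendsto_const ulim)
  qed (use b01 in auto)
  have Llim: "L \<longlonglongrightarrow> ?L"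
  proof -
    have "(\<lambda>j. \<integral>y. u m j y * indicator (A m) y \<partial>lborel) \<longlonglongrightarrow> (\<integral>y. q m y * indicator (A m) y \<partial>lborel)" if m: "m \<in> I" for m
    proof (rule integral_dominated_convergence[OF _ _ int[OF m]])
      show "AE y in lborel. (\<lambda>j. u m j y * indicator (A m) y) \<longlonglongrightarrow> q m y * indicator (A m) y"
        by (intro AE_I2 tendsto_mult tendsto_const ulim m)
    qed (use m u0 uq in \<open>auto simp: abs_mult indicator_def\<close>)
    then show ?thesis unfolding L_def[abs_def] by (intro tendsto_intros)
  qed
  have lower: "?L \<le> expectation (a n)" for n
    using Lb by (intro LIMSEQ_le[OF Llim alim]) auto
  show ?thesis
    unfolding a_def[symmetric]
  proof (rule order_tendstoI)
    fix x assume "x < ?L"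
    then show "\<forall>\<^sub>F n in sequentially. x < expectation (a n)"
      using less_le_trans[OF _ lower] by (intro always_eventually allI) blast
  next
    fix x assume "?L < x"
    then obtain j where "L j < x"
      using order_tendstoD(2)[OF Llim] by (auto simp: eventually_sequentially)
    then have "\<forall>\<^sub>F n in sequentially. expectation (b j n) < x" by (rule order_tendstoD(2)[OF blim])
    then show "\<forall>\<^sub>F n in sequentially. expectation (a n) < x"
      by eventually_elim (auto intro: order_le_less_trans[OF integral_mono[OF ia ib ab]])
  qed
qed

section \<open>Independence and exponential random variables\<close>

text \<open>The joint map into the product space is measurable for the sigma-algebra generated by
  the family. This is how independence of two families of events becomes independence of two random
  elements.\<close>

lemma generated_events_PiM:
  "{(\<lambda>\<omega>. \<lambda>l\<in>I. V l \<omega>) -` C \<inter> space M | C. C \<in> sets (PiM I (\<lambda>_. borel))} \<subseteq> generated_events M I V"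
proof -
  define G where "G = (\<Union>l\<in>I. {V l -` C \<inter> space M | C. C \<in> sets borel})"
  have G: "G \<subseteq> Pow (space M)" by (auto simp: G_def)
  have "V l \<in> sigma (space M) G \<rightarrow>\<^sub>M borel" if "l \<in> I" for l
    by (rule measurableI) (use that G in \<open>auto simp: space_measure_of_conv sets_measure_of intro!: sigma_sets.Basic, auto simp: G_def\<close>)
  then have "(\<lambda>\<omega>. \<lambda>l\<in>I. V l \<omega>) \<in> sigma (space M) G \<rightarrow>\<^sub>M PiM I (\<lambda>_. borel)"
    by (rule measurable_restrict)
  from measurable_sets[OF this] show ?thesis
    using G by (auto simp: generated_events_def G_def[symmetric] space_measure_of_conv)
qed

text \<open>The library's \<open>indep_var\<close> forces both random elements to take values in the same type.\<close>

definition (in prob_space) indep_pair ::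
    "'b measure \<Rightarrow> ('a \<Rightarrow> 'b) \<Rightarrow> 'c measure \<Rightarrow> ('a \<Rightarrow> 'c) \<Rightarrow> bool" where
  "indep_pair M1 X M2 Y \<longleftrightarrow> random_variable M1 X \<and> random_variable M2 Y \<and>
     (\<forall>A\<in>sets M1. \<forall>B\<in>sets M2. prob ((X -` A \<inter> space M) \<inter> (Y -` B \<inter> space M)) =
        prob (X -` A \<inter> space M) * prob (Y -` B \<inter> space M))"

lemma (in prob_space) indep_pair_generated_events:
  assumes "indep_set (generated_events M I V) (generated_events M J W)"
  shows "indep_pair (PiM I (\<lambda>_. borel)) (\<lambda>\<omega>. \<lambda>l\<in>I. V l \<omega>) (PiM J (\<lambda>_. borel)) (\<lambda>\<omega>. \<lambda>l\<in>J. W l \<omega>)"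
proof -
  have ev: "generated_events M I V \<subseteq> events" "generated_events M J W \<subseteq> events"
    using indep_setD_ev1[OF assms] indep_setD_ev2[OF assms] by auto
  have "random_variable (PiM I (\<lambda>_. borel)) (\<lambda>\<omega>. \<lambda>l\<in>I. V l \<omega>)"
    using generated_events_PiM[where I = I and V = V and M = M] ev(1) by (auto intro!: measurableI simp: space_PiM)
  moreover have "random_variable (PiM J (\<lambda>_. borel)) (\<lambda>\<omega>. \<lambda>l\<in>J. W l \<omega>)"
    using generated_events_PiM[where I = J and V = W and M = M] ev(2) by (auto intro!: measurableI simp: space_PiM)
  ultimately show ?thesis
    unfolding indep_pair_def
    using generated_events_PiM[where I = I and V = V and M = M] generated_events_PiM[where I = J and V = W and M = M]
    by (intro conjI ballI indep_setD[OF assms]) auto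
qed

lemma (in prob_space) indep_pair_compose:
  assumes ind: "indep_pair M1 X M2 Y" and [measurable]: "f \<in> M1 \<rightarrow>\<^sub>M N1" "f' \<in> M2 \<rightarrow>\<^sub>M N2"
  shows "indep_pair N1 (\<lambda>\<omega>. f (X \<omega>)) N2 (\<lambda>\<omega>. f' (Y \<omega>))"
proof -
  have X[measurable]: "random_variable M1 X" and Y[measurable]: "random_variable M2 Y"
    using ind by (auto simp: indep_pair_def)
  have eqX: "(\<lambda>\<omega>. f (X \<omega>)) -` A \<inter> space M = X -` (f -` A \<inter> space M1) \<inter> space M" for A
    using measurable_space[OF X] by auto
  have eqY: "(\<lambda>\<omega>. f' (Y \<omega>)) -` A \<inter> space M = Y -` (f' -` A \<inter> space M2) \<inter> space M" for A
    using measurable_space[OF Y] by auto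
  show ?thesis
    unfolding indep_pair_def eqX eqY
    using ind[unfolded indep_pair_def, THEN conjunct2, THEN conjunct2, rule_format]
    by (intro conjI ballI) (auto simp: measurable_sets[OF assms(2)] measurable_sets[OF assms(3)] simp del: vimage_Int)
qed

lemma (in prob_space) indep_pair_restrict:
  assumes ind: "indep_vars M' X I" and AB: "A \<inter> B = {}" "A \<subseteq> I" "B \<subseteq> I"
  shows "indep_pair (PiM A M') (\<lambda>\<omega>. restrict (\<lambda>i. X i \<omega>) A) (PiM B M') (\<lambda>\<omega>. restrict (\<lambda>i. X i \<omega>) B)"
  using indep_var_restrict[OF assms] unfolding indep_pair_def indep_var_eq
  by (intro conjI ballI indep_setD) (auto intro: sigma_sets.Basic)

text \<open>Independence makes the joint law the product of the marginals, and Tonelli's theorem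
  applies. On the right both integrals run over the same space: \<omega>' freezes \<open>Y\<close>
  while \<omega> averages over \<open>X\<close>.\<close>

lemma (in prob_space) indep_pair_nn_integral_iterated:
  assumes ind: "indep_pair M1 X M2 Y" and F[measurable]: "F \<in> borel_measurable (M1 \<Otimes>\<^sub>M M2)"
  shows "(\<integral>\<^sup>+\<omega>. F (X \<omega>, Y \<omega>) \<partial>M) = (\<integral>\<^sup>+\<omega>'. (\<integral>\<^sup>+\<omega>. F (X \<omega>, Y \<omega>') \<partial>M) \<partial>M)"
proof -
  have X[measurable]: "random_variable M1 X" and Y[measurable]: "random_variable M2 Y"
    using ind by (auto simp: indep_pair_def)
  interpret X: prob_space "distr M M1 X" by (rule prob_space_distr) measurable
  interpret Y: prob_space "distr M M2 Y" by (rule prob_space_distr) measurable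
  interpret XY: pair_sigma_finite "distr M M1 X" "distr M M2 Y" ..
  have [measurable]: "F \<in> borel_measurable (distr M M1 X \<Otimes>\<^sub>M distr M M2 Y)"
    by (subst measurable_cong_sets[OF sets_pair_measure_cong[OF sets_distr sets_distr] refl]) (rule F)
  have distr: "distr M M1 X \<Otimes>\<^sub>M distr M M2 Y = distr M (M1 \<Otimes>\<^sub>M M2) (\<lambda>\<omega>. (X \<omega>, Y \<omega>))"
  proof (rule pair_measure_eqI)
    fix A B assume "A \<in> sets (distr M M1 X)" "B \<in> sets (distr M M2 Y)"
    then have AB[measurable]: "A \<in> sets M1" "B \<in> sets M2" by auto
    have "(\<lambda>\<omega>. (X \<omega>, Y \<omega>)) -` (A \<times> B) \<inter> space M = (X -` A \<inter> space M) \<inter> (Y -` B \<inter> space M)" by auto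
    then show "emeasure (distr M M1 X) A * emeasure (distr M M2 Y) B =
        emeasure (distr M (M1 \<Otimes>\<^sub>M M2) (\<lambda>\<omega>. (X \<omega>, Y \<omega>))) (A \<times> B)"
      using ind AB by (simp add: emeasure_distr emeasure_eq_measure indep_pair_def ennreal_mult)
  qed (auto intro: X.sigma_finite_measure_axioms Y.sigma_finite_measure_axioms)
  have "(\<integral>\<^sup>+\<omega>. F (X \<omega>, Y \<omega>) \<partial>M) = integral\<^sup>N (distr M (M1 \<Otimes>\<^sub>M M2) (\<lambda>\<omega>. (X \<omega>, Y \<omega>))) F"
    by (subst nn_integral_distr) auto
  also have "\<dots> = (\<integral>\<^sup>+y. (\<integral>\<^sup>+x. F (x, y) \<partial>distr M M1 X) \<partial>distr M M2 Y)"
    by (simp add: distr[symmetric] XY.nn_integral_snd)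
  also have "\<dots> = (\<integral>\<^sup>+\<omega>'. (\<integral>\<^sup>+x. F (x, Y \<omega>') \<partial>distr M M1 X) \<partial>M)"
    by (subst nn_integral_distr) auto
  also have "\<dots> = (\<integral>\<^sup>+\<omega>'. (\<integral>\<^sup>+\<omega>. F (X \<omega>, Y \<omega>') \<partial>M) \<partial>M)"
  proof (rule nn_integral_cong)
    fix \<omega>' assume "\<omega>' \<in> space M"
    then have [simp]: "Y \<omega>' \<in> space M2" by (rule measurable_space[OF Y])
    show "(\<integral>\<^sup>+x. F (x, Y \<omega>') \<partial>distr M M1 X) = (\<integral>\<^sup>+\<omega>. F (X \<omega>, Y \<omega>') \<partial>M)"
      by (subst nn_integral_distr) auto
  qed
  finally show ?thesis .
qed

section \<open>Exponential random variables\<close>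

lemma (in prob_space) exponential_laplace:
  assumes D: "distributed M lborel X (\<lambda>y. ennreal (exponential_density 1 y))" and a: "a \<ge> 0"
  shows "(\<integral>\<^sup>+\<omega>. ennreal (exp (- (a * X \<omega>))) \<partial>M) = ennreal (1 / (1 + a))"
proof -
  have a1: "1 + a > 0" using a by simp
  interpret E: prob_space "density lborel (exponential_density (1 + a))"
    using prob_space_exponential_density[OF a1] .
  have "(\<integral>\<^sup>+\<omega>. ennreal (exp (- (a * X \<omega>))) \<partial>M) =
      (\<integral>\<^sup>+y. ennreal (exponential_density 1 y) * ennreal (exp (- (a * y))) \<partial>lborel)"
    by (subst distributed_nn_integral[OF D]) auto
  \<comment> \<open>The factor exp (- a y) tilts the density of rate 1 into 1 / (1 + a) times the
    density of rate 1 + a, which has mass 1.\<close>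
  also have "\<dots> = (\<integral>\<^sup>+y. ennreal (1 / (1 + a)) * ennreal (exponential_density (1 + a) y) \<partial>lborel)"
  proof (rule nn_integral_cong)
    fix y
    have "exponential_density 1 y * exp (- (a * y)) = 1 / (1 + a) * exponential_density (1 + a) y"
      using a1 by (auto simp: exponential_density_def exp_add[symmetric] distrib_left mult.commute)
    then show "ennreal (exponential_density 1 y) * ennreal (exp (- (a * y))) =
        ennreal (1 / (1 + a)) * ennreal (exponential_density (1 + a) y)"
      using a1 by (simp add: ennreal_mult'[symmetric] ennreal_mult''[symmetric])
  qed
  also have "\<dots> = ennreal (1 / (1 + a)) * (\<integral>\<^sup>+y. ennreal (exponential_density (1 + a) y) \<partial>lborel)"
    by (rule nn_integral_cmult) auto
  also have "(\<integral>\<^sup>+y. ennreal (exponential_density (1 + a) y) \<partial>lborel) = 1"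
    using E.emeasure_space_1 by (simp add: emeasure_density)
  finally show ?thesis by simp
qed

lemma (in prob_space) exponential_AE_pos:
  assumes D: "distributed M lborel X (\<lambda>y. ennreal (exponential_density 1 y))"
  shows "AE \<omega> in M. X \<omega> > 0"
proof -
  have "AE \<omega> in M. \<omega> \<in> {\<omega> \<in> space M. 0 < X \<omega>}"
    using exponential_distributedD_gt[OF D, of 0] by (intro AE_prob_1) simp
  then show ?thesis by simp
qed

text \<open>The layer-cake formula for \<open>ln (1 + X / w)\<close>, in which the tail of \<open>X\<close> is exponential.\<close>

lemma (in prob_space) exponential_log_expectation:
  assumes D: "distributed M lborel X (\<lambda>y. ennreal (exponential_density 1 y))" and w: "w > 0"
  shows "(\<integral>\<^sup>+\<omega>. ennreal (ln (1 + X \<omega> / w)) \<partial>M) =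
    (\<integral>\<^sup>+t. ennreal (exp (- ((exp t - 1) * w))) * indicator {0<..} t \<partial>lborel)"
proof -
  have [measurable]: "random_variable borel X" using distributed_measurable[OF D] by simp
  interpret P: pair_sigma_finite M lborel ..
  have "(\<integral>\<^sup>+\<omega>. ennreal (ln (1 + X \<omega> / w)) \<partial>M) =
     (\<integral>\<^sup>+\<omega>. (\<integral>\<^sup>+t. indicator {0<..} t * indicator {(exp t - 1) * w<..} (X \<omega>) \<partial>lborel) \<partial>M)"
  proof (rule nn_integral_cong_AE)
    from exponential_AE_pos[OF D]
    show "AE \<omega> in M. ennreal (ln (1 + X \<omega> / w)) =
       (\<integral>\<^sup>+t. indicator {0<..} t * indicator {(exp t - 1) * w<..} (X \<omega>) \<partial>lborel)"
    proof eventually_elim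
      case (elim \<omega>)
      have pos: "1 + X \<omega> / w > 0" using elim w by (intro add_pos_pos) auto
      have iff: "(exp t - 1) * w < X \<omega> \<longleftrightarrow> t < ln (1 + X \<omega> / w)" for t
      proof -
        have "(exp t - 1) * w < X \<omega> \<longleftrightarrow> exp t - 1 < X \<omega> / w"
          by (rule pos_less_divide_eq[OF w, symmetric])
        also have "\<dots> \<longleftrightarrow> exp t < exp (ln (1 + X \<omega> / w))" using pos by (simp add: diff_less_eq add.commute)
        finally show ?thesis by simp
      qed
      have "(\<integral>\<^sup>+t. indicator {0<..} t * indicator {(exp t - 1) * w<..} (X \<omega>) \<partial>lborel) =
         (\<integral>\<^sup>+t. indicator {0<..<ln (1 + X \<omega> / w)} t \<partial>lborel)"
        by (intro nn_integral_cong) (auto simp: iff split: split_indicator)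
      also have "\<dots> = ennreal (ln (1 + X \<omega> / w))"
        using elim w by simp
      finally show ?case by simp
    qed
  qed
  also have "\<dots> = (\<integral>\<^sup>+t. (\<integral>\<^sup>+\<omega>. indicator {0<..} t * indicator {(exp t - 1) * w<..} (X \<omega>) \<partial>M) \<partial>lborel)"
    by (intro P.Fubini'[symmetric]) (auto simp: indicator_def)
  also have "\<dots> = (\<integral>\<^sup>+t. ennreal (exp (- ((exp t - 1) * w))) * indicator {0<..} t \<partial>lborel)"
  proof (rule nn_integral_cong)
    fix t :: real
    have "(\<integral>\<^sup>+\<omega>. indicator {(exp t - 1) * w<..} (X \<omega>) \<partial>M) = ennreal (exp (- ((exp t - 1) * w)))" if "t > 0"
    proof -
      have "(\<integral>\<^sup>+\<omega>. indicator {(exp t - 1) * w<..} (X \<omega>) \<partial>M) =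
          (\<integral>\<^sup>+\<omega>. indicator {\<omega> \<in> space M. (exp t - 1) * w < X \<omega>} \<omega> \<partial>M)"
        by (intro nn_integral_cong) (auto split: split_indicator)
      also have "\<dots> = ennreal (prob {\<omega> \<in> space M. (exp t - 1) * w < X \<omega>})"
        by (subst nn_integral_indicator) (auto simp: emeasure_eq_measure)
      also have "\<dots> = ennreal (exp (- ((exp t - 1) * w)))"
        using that w by (subst exponential_distributedD_gt[OF D]) auto
      finally show ?thesis .
    qed
    then show "(\<integral>\<^sup>+\<omega>. indicator {0<..} t * indicator {(exp t - 1) * w<..} (X \<omega>) \<partial>M) =
       ennreal (exp (- ((exp t - 1) * w))) * indicator {0<..} t"
      by (auto split: split_indicator)
  qed
  finally show ?thesis .
qed

section \<open>Laplace transform of the interference\<close>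

text \<open>The whole plane dominates every region \<open>A\<close>, so one estimate serves all
  tiers.\<close>

lemma kernel_integral:
  assumes \<beta>: "\<beta> > 2" and c: "c > 0" and A[measurable]: "A \<in> sets borel"
  shows "integrable lborel (\<lambda>z. kernel \<beta> c z * indicator A z)"
    and "(\<integral>z. kernel \<beta> c z * indicator A z \<partial>lborel) \<le> pi * c powr (2 / \<beta>) * radial_const \<beta>"
proof -
  have le: "(\<integral>\<^sup>+z. ennreal (kernel \<beta> c z * indicator A z) \<partial>lborel) \<le> ennreal (pi * c powr (2 / \<beta>) * radial_const \<beta>)"
    unfolding nn_integral_interference_kernel_plane[OF \<beta> c, symmetric]
    using kernel_bounds[of c \<beta>] c by (intro nn_integral_mono) (auto simp: kernel_def split: split_indicator)
  then show int: "integrable lborel (\<lambda>z. kernel \<beta> c z * indicator A z)"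
    using kernel_bounds[of c \<beta>] c
    by (intro integrableI_bounded) (auto simp: abs_mult elim: order_le_less_trans)
  show "(\<integral>z. kernel \<beta> c z * indicator A z \<partial>lborel) \<le> pi * c powr (2 / \<beta>) * radial_const \<beta>"
    using le kernel_bounds[of c \<beta>] c
    by (subst (asm) nn_integral_eq_integral[OF int]) (auto simp: radial_const_def)
qed

text \<open>The network at a fixed distance of the serving node, with arbitrary Borel sets as
  interferer regions: the Laplace transform depends on them only through the kernel
  integrals.\<close>

locale rayleigh_network = prob_space +
  fixes P \<mu> :: "nat \<Rightarrow> real" and \<beta> :: real and A :: "nat \<Rightarrow> (real^2) set"
    and g :: "'a \<Rightarrow> real" and h :: "nat \<Rightarrow> nat \<Rightarrow> 'a \<Rightarrow> real" and Y :: "nat \<Rightarrow> nat \<Rightarrow> 'a \<Rightarrow> real^2"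
  assumes \<beta>: "\<beta> > 2"
    and P_pos: "\<And>m. m \<in> {1..3} \<Longrightarrow> P m > 0"
    and \<mu>_nonneg: "\<And>m. m \<in> {1..3} \<Longrightarrow> \<mu> m \<ge> 0"
    and A_borel: "\<And>m. m \<in> {1..3} \<Longrightarrow> A m \<in> sets borel"
    and process: "\<And>m. m \<in> {1..3} \<Longrightarrow> poisson_process M (\<mu> m) (A m) (Y m)"
    and process_indep: "indep_sets (\<lambda>m. process_events M (Y m)) {1..3}"
    and gain_exp: "\<And>l. l \<in> links \<Longrightarrow>
      distributed M lborel (gain g h l) (\<lambda>y. ennreal (exponential_density 1 y))"
    and gain_indep: "indep_vars (\<lambda>_. borel) (gain g h) links"
    and gain_process_indep: "indep_set (generated_events M links (gain g h))
      (generated_events M ({1..3} \<times> UNIV) (\<lambda>(m, k). Y m k))"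
begin

text \<open>Minus the logarithm of the Laplace transform of the interference, as
  \<open>interference_laplace\<close> shows for \<open>s > 0\<close>.\<close>

definition exponent :: "real \<Rightarrow> real" where
  "exponent s = (\<Sum>m\<in>{1..3}. \<mu> m * (\<integral>z. kernel \<beta> (s * P m) z * indicator (A m) z \<partial>lborel))"

definition partial_interference :: "nat \<Rightarrow> 'a \<Rightarrow> real" where
  "partial_interference n \<omega> = (\<Sum>m\<in>{1..3}. \<Sum>k<n. P m * h m k \<omega> * norm (Y m k \<omega>) powr (- \<beta>))"

abbreviation pairs :: "(nat \<times> nat) set" where "pairs \<equiv> {1..3} \<times> UNIV"

definition gains :: "'a \<Rightarrow> (nat \<times> nat) option \<Rightarrow> real" where
  "gains \<omega> = (\<lambda>l\<in>links. gain g h l \<omega>)"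

definition positions :: "'a \<Rightarrow> nat \<times> nat \<Rightarrow> real^2" where
  "positions \<omega> = (\<lambda>p\<in>pairs. (case p of (m, k) \<Rightarrow> Y m k) \<omega>)"

lemma links_simps [simp]: "None \<in> links" "Some (m, k) \<in> links \<longleftrightarrow> m \<in> {1..3}"
  by (auto simp: links_def)

lemma indep_gains_positions:
  "indep_pair (PiM links (\<lambda>_. borel)) gains (PiM pairs (\<lambda>_. borel)) positions"
  using indep_pair_generated_events[OF gain_process_indep]
  unfolding gains_def[abs_def] positions_def[abs_def] .

lemma gain_simps [simp]: "gain g h None = g" "gain g h (Some (m, k)) = h m k"
  by (auto simp: gain_def)

lemma g_exp: "distributed M lborel g (\<lambda>y. ennreal (exponential_density 1 y))"
  using gain_exp[of None] by simp

lemma h_exp: "m \<in> {1..3} \<Longrightarrow> distributed M lborel (h m k) (\<lambda>y. ennreal (exponential_density 1 y))"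
  using gain_exp[of "Some (m, k)"] by simp

lemma g_measurable [measurable]: "random_variable borel g"
  using distributed_measurable[OF g_exp] by simp

lemma h_measurable [measurable (raw)]: "m \<in> {1..3} \<Longrightarrow> random_variable borel (h m k)"
  using distributed_measurable[OF h_exp] by simp

lemma Y_measurable [measurable (raw)]: "m \<in> {1..3} \<Longrightarrow> random_variable borel (Y m k)"
  by (rule poisson_processD(1)[OF process])

lemma interference_term_measurable:
  assumes m: "m \<in> {1..3}"
  shows "random_variable borel (\<lambda>\<omega>. P m * h m k \<omega> * norm (Y m k \<omega>) powr (- \<beta>))"
proof -
  note [measurable] = h_measurable[OF m] Y_measurable[OF m]
  show ?thesis by measurable
qed

lemma partial_interference_measurable [measurable]: "random_variable borel (partial_interference n)"
  unfolding partial_interference_def[abs_def]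
  by (intro borel_measurable_sum interference_term_measurable)

lemma interference_measurable [measurable]: "random_variable borel (interference P \<beta> h Y)"
  unfolding interference_def[abs_def]
  by (intro borel_measurable_sum borel_measurable_suminf interference_term_measurable)

lemma AE_h_pos: "AE \<omega> in M. \<forall>m\<in>{1..3}. \<forall>k. h m k \<omega> > 0"
  by (intro AE_finite_allI AE_all_countable[THEN iffD2] allI exponential_AE_pos h_exp) auto

lemma gains_laplace:
  assumes a: "\<And>m k. m \<in> {1..3} \<Longrightarrow> a m k \<ge> 0"
  shows "(\<integral>\<^sup>+\<omega>. ennreal (exp (- (\<Sum>m\<in>{1..3}. \<Sum>k<n. a m k * h m k \<omega>))) \<partial>M) =
    ennreal (\<Prod>m\<in>{1..3}. \<Prod>k<n. 1 / (1 + a m k))"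
proof -
  let ?I = "{1..3} \<times> {..<n}"
  let ?L = "Some ` ?I"
  define b where "b l = (case l of None \<Rightarrow> 0 | Some (m, k) \<Rightarrow> a m k)" for l
  have L: "?L \<subseteq> links" by (auto simp: links_def)
  have b: "b l \<ge> 0" if "l \<in> ?L" for l using that a by (auto simp: b_def)
  have ind: "indep_vars (\<lambda>_. borel) (\<lambda>l \<omega>. ennreal (exp (- (b l * gain g h l \<omega>)))) ?L"
    by (rule indep_vars_compose2[OF indep_vars_subset[OF gain_indep L], where Y = "\<lambda>l y. ennreal (exp (- (b l * y)))"]) measurable
  have "(\<integral>\<^sup>+\<omega>. ennreal (exp (- (\<Sum>m\<in>{1..3}. \<Sum>k<n. a m k * h m k \<omega>))) \<partial>M) =
    (\<integral>\<^sup>+\<omega>. (\<Prod>l\<in>?L. ennreal (exp (- (b l * gain g h l \<omega>)))) \<partial>M)"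
    by (intro nn_integral_cong)
      (simp add: sum.cartesian_product sum_negf[symmetric] exp_sum prod_ennreal split_beta gain_def prod.reindex b_def)
  also have "\<dots> = (\<Prod>l\<in>?L. \<integral>\<^sup>+\<omega>. ennreal (exp (- (b l * gain g h l \<omega>))) \<partial>M)"
    by (intro indep_vars_nn_integral ind) auto
  also have "\<dots> = (\<Prod>l\<in>?L. ennreal (1 / (1 + b l)))"
    using L b by (intro prod.cong refl exponential_laplace gain_exp) auto
  also have "\<dots> = ennreal (\<Prod>l\<in>?L. 1 / (1 + b l))"
    by (intro prod_ennreal divide_nonneg_nonneg add_nonneg_nonneg b) auto
  also have "(\<Prod>l\<in>?L. 1 / (1 + b l)) = (\<Prod>m\<in>{1..3}. \<Prod>k<n. 1 / (1 + a m k))"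
    by (simp add: prod.cartesian_product split_beta prod.reindex b_def)
  finally show ?thesis .
qed

lemma partial_interference_laplace:
  assumes s: "s > 0"
  shows "expectation (\<lambda>\<omega>. exp (- (s * partial_interference n \<omega>))) =
    expectation (\<lambda>\<omega>. \<Prod>m\<in>{1..3}. \<Prod>k<n. 1 - kernel \<beta> (s * P m) (Y m k \<omega>))"
proof -
  \<comment> \<open>The integrand as a function of a family of gains and a family of positions, the
    form in which \<open>indep_pair_nn_integral_iterated\<close> applies.\<close>
  define F where "F x = ennreal (exp (- (\<Sum>m\<in>{1..3}. \<Sum>k<n. (s * (P m * norm (snd x (m, k)) powr (- \<beta>))) * fst x (Some (m, k)))))"
    for x :: "((nat \<times> nat) option \<Rightarrow> real) \<times> (nat \<times> nat \<Rightarrow> real^2)"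
  have F: "F \<in> borel_measurable (PiM links (\<lambda>_. borel) \<Otimes>\<^sub>M PiM pairs (\<lambda>_. borel))"
  proof -
    have [measurable]: "(\<lambda>x. fst x (Some (m, k))) \<in> borel_measurable (PiM links (\<lambda>_. borel) \<Otimes>\<^sub>M PiM pairs (\<lambda>_. borel :: (real^2) measure))"
      if "m \<in> {1..3}" for m k
      using that by (intro measurable_compose[OF measurable_fst measurable_component_singleton]) auto
    have [measurable]: "(\<lambda>x. snd x (m, k)) \<in> borel_measurable (PiM links (\<lambda>_. borel :: real measure) \<Otimes>\<^sub>M PiM pairs (\<lambda>_. borel :: (real^2) measure))"
      if "m \<in> {1..3}" for m k
      using that by (intro measurable_compose[OF measurable_snd measurable_component_singleton]) auto
    show ?thesis unfolding F_def[abs_def] by measurable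
  qed
  have FS: "ennreal (exp (- (s * partial_interference n \<omega>))) = F (gains \<omega>, positions \<omega>)" for \<omega>
    unfolding F_def partial_interference_def sum_distrib_left
    by (intro arg_cong[where f = "\<lambda>x. ennreal (exp (- x))"] sum.cong refl)
       (auto simp: gains_def positions_def)
  have prod01: "0 \<le> (\<Prod>m\<in>{1..3}. \<Prod>k<n. 1 - kernel \<beta> (s * P m) (Y m k \<omega>))"
    "(\<Prod>m\<in>{1..3}. \<Prod>k<n. 1 - kernel \<beta> (s * P m) (Y m k \<omega>)) \<le> 1" for \<omega>
    using kernel_bounds s P_pos by (auto intro!: prod_nonneg prod_le_1 simp: less_imp_le)
  have "(\<integral>\<^sup>+\<omega>. ennreal (exp (- (s * partial_interference n \<omega>))) \<partial>M) =
      (\<integral>\<^sup>+\<omega>'. (\<integral>\<^sup>+\<omega>. F (gains \<omega>, positions \<omega>') \<partial>M) \<partial>M)"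
    unfolding FS by (rule indep_pair_nn_integral_iterated[OF indep_gains_positions F])
  also have "\<dots> = (\<integral>\<^sup>+\<omega>'. ennreal (\<Prod>m\<in>{1..3}. \<Prod>k<n. 1 - kernel \<beta> (s * P m) (Y m k \<omega>')) \<partial>M)"
  proof (rule nn_integral_cong)
    fix \<omega>'
    have "(\<integral>\<^sup>+\<omega>. F (gains \<omega>, positions \<omega>') \<partial>M) =
       (\<integral>\<^sup>+\<omega>. ennreal (exp (- (\<Sum>m\<in>{1..3}. \<Sum>k<n. (s * (P m * norm (Y m k \<omega>') powr (- \<beta>))) * h m k \<omega>))) \<partial>M)"
      unfolding F_def
      by (intro nn_integral_cong arg_cong[where f = "\<lambda>x. ennreal (exp (- x))"] sum.cong refl)
         (auto simp: gains_def positions_def)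
    also have "\<dots> = ennreal (\<Prod>m\<in>{1..3}. \<Prod>k<n. 1 / (1 + s * (P m * norm (Y m k \<omega>') powr (- \<beta>))))"
      using s P_pos by (intro gains_laplace) (auto intro!: mult_nonneg_nonneg simp: less_imp_le)
    finally show "(\<integral>\<^sup>+\<omega>. F (gains \<omega>, positions \<omega>') \<partial>M) = ennreal (\<Prod>m\<in>{1..3}. \<Prod>k<n. 1 - kernel \<beta> (s * P m) (Y m k \<omega>'))"
      by (simp add: kernel_def mult.assoc)
  qed
  finally have eq: "(\<integral>\<^sup>+\<omega>. ennreal (exp (- (s * partial_interference n \<omega>))) \<partial>M) =
     (\<integral>\<^sup>+\<omega>. ennreal (\<Prod>m\<in>{1..3}. \<Prod>k<n. 1 - kernel \<beta> (s * P m) (Y m k \<omega>)) \<partial>M)" .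
  have m: "random_variable borel (\<lambda>\<omega>. \<Prod>m\<in>{1..3}. \<Prod>k<n. 1 - kernel \<beta> (s * P m) (Y m k \<omega>))"
    by (intro borel_measurable_prod borel_measurable_diff borel_measurable_const measurable_compose[OF Y_measurable kernel_measurable])
  show ?thesis
    using eq prod01 by (subst (1 2) integral_eq_nn_integral) (auto intro: m)
qed

lemma partial_interference_laplace_limit:
  assumes s: "s > 0"
  shows "(\<lambda>n. expectation (\<lambda>\<omega>. exp (- (s * partial_interference n \<omega>)))) \<longlonglongrightarrow> exp (- exponent s)"
  unfolding partial_interference_laplace[OF s] exponent_def
  using kernel_bounds kernel_integral(1)[OF \<beta>] s P_pos A_borel
  by (intro poisson_pgfl process process_indep \<mu>_nonneg A_borel) (auto simp: less_imp_le)

text \<open>The order s^(2/\<beta>) comes from scaling in the plane. It makes the exponent vanish as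
  s -> 0, which is what forces the interference to be finite.\<close>

lemma exponent_le:
  assumes s: "s > 0"
  shows "exponent s \<le> (\<Sum>m\<in>{1..3}. \<mu> m * (pi * P m powr (2 / \<beta>) * radial_const \<beta>)) * s powr (2 / \<beta>)"
  unfolding exponent_def sum_distrib_right
proof (rule sum_mono)
  fix m assume m: "m \<in> {1..3::nat}"
  have "(\<integral>z. kernel \<beta> (s * P m) z * indicator (A m) z \<partial>lborel) \<le> pi * (s * P m) powr (2 / \<beta>) * radial_const \<beta>"
    using s P_pos[OF m] A_borel[OF m] by (intro kernel_integral(2) \<beta>) auto
  also have "\<dots> = pi * P m powr (2 / \<beta>) * radial_const \<beta> * s powr (2 / \<beta>)"
    using s P_pos[OF m] by (simp add: powr_mult)
  finally show "\<mu> m * (\<integral>z. kernel \<beta> (s * P m) z * indicator (A m) z \<partial>lborel)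
      \<le> \<mu> m * (pi * P m powr (2 / \<beta>) * radial_const \<beta>) * s powr (2 / \<beta>)"
    using \<mu>_nonneg[OF m] by (simp add: mult_left_mono mult.assoc)
qed

section \<open>Almost sure convergence and positivity of the interference\<close>

lemma partial_interference_nonneg:
  assumes "\<forall>m\<in>{1..3}. \<forall>k. h m k \<omega> > 0"
  shows "partial_interference n \<omega> \<ge> 0"
  unfolding partial_interference_def using assms P_pos
  by (intro sum_nonneg mult_nonneg_nonneg) (auto simp: less_imp_le)

lemma partial_interference_mono:
  assumes "\<forall>m\<in>{1..3}. \<forall>k. h m k \<omega> > 0"
  shows "incseq (\<lambda>n. partial_interference n \<omega>)"
proof (rule incseq_SucI)
  fix n show "partial_interference n \<omega> \<le> partial_interference (Suc n) \<omega>"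
    unfolding partial_interference_def using assms P_pos
    by (intro sum_mono) (auto simp: less_imp_le)
qed

text \<open>Where the partial sums diverge, their Laplace transforms vanish in the limit, so the
  probability of boundedness is at least \<open>exp (- exponent s)\<close> for every \<open>s > 0\<close>.\<close>

lemma AE_partial_interference_bounded: "AE \<omega> in M. \<exists>c::nat. \<forall>n. partial_interference n \<omega> \<le> real c"
proof -
  \<comment> \<open>Bounds are taken among the natural numbers, which makes \<open>B\<close> a
    countable union and so an event.\<close>
  define B where "B = {\<omega> \<in> space M. \<exists>c::nat. \<forall>n. partial_interference n \<omega> \<le> real c}"
  have B_ev[measurable]: "B \<in> events" unfolding B_def by measurable
  have lower: "exp (- exponent s) \<le> prob B" if s: "s > 0" for s
  proof -
    have "(\<lambda>n. expectation (\<lambda>\<omega>. exp (- (s * partial_interference n \<omega>)) * indicator (space M - B) \<omega>)) \<longlonglongrightarrow> expectation (\<lambda>_. 0)"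
    proof (rule integral_dominated_convergence[where w = "\<lambda>_. 1"])
      show "AE \<omega> in M. (\<lambda>n. exp (- (s * partial_interference n \<omega>)) * indicator (space M - B) \<omega>) \<longlonglongrightarrow> 0"
        using AE_h_pos AE_space
      proof eventually_elim
        case (elim \<omega>)
        show ?case
        proof (cases "\<omega> \<in> B")
          case False
          have "filterlim (\<lambda>n. partial_interference n \<omega>) at_top sequentially"
            unfolding filterlim_at_top
          proof
            fix Z
            obtain c :: nat where c: "Z \<le> real c" using real_arch_simple by blast
            obtain n where "partial_interference n \<omega> > real c"
              using False elim(2) by (force simp: B_def not_le)
            then show "\<forall>\<^sub>F n in sequentially. Z \<le> partial_interference n \<omega>"
              using c incseqD[OF partial_interference_mono[OF elim(1)]]
              by (intro eventually_sequentiallyI[of n]) (meson le_less_trans less_imp_le order_trans)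
          qed
          then have "filterlim (\<lambda>n. s * partial_interference n \<omega>) at_top sequentially"
            by (rule filterlim_tendsto_pos_mult_at_top[OF tendsto_const s])
          then have "(\<lambda>n. exp (- (s * partial_interference n \<omega>))) \<longlonglongrightarrow> 0"
            by (intro filterlim_compose[OF exp_at_bot] filterlim_compose[OF filterlim_uminus_at_bot_at_top])
          then show ?thesis using False elim(2) by simp
        qed simp
      qed
      show "AE \<omega> in M. norm (exp (- (s * partial_interference n \<omega>)) * indicator (space M - B) \<omega>) \<le> 1" for n
        using AE_h_pos by eventually_elim (simp add: partial_interference_nonneg s less_imp_le indicator_def)
    qed auto
    then have lim: "(\<lambda>n. prob B + expectation (\<lambda>\<omega>. exp (- (s * partial_interference n \<omega>)) * indicator (space M - B) \<omega>)) \<longlonglongrightarrow> prob B"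
      by (auto intro!: tendsto_eq_intros)
    \<comment> \<open>On \<open>B\<close> the exponential is almost surely at most 1, and the
      contribution of the complement tends to 0. Hence the limit of the transforms is at most
      \<open>prob B\<close>.\<close>
    have "expectation (\<lambda>\<omega>. exp (- (s * partial_interference n \<omega>))) \<le>
       prob B + expectation (\<lambda>\<omega>. exp (- (s * partial_interference n \<omega>)) * indicator (space M - B) \<omega>)" for n
    proof -
      have int: "integrable M (\<lambda>\<omega>. exp (- (s * partial_interference n \<omega>)))"
      proof (rule integrable_const_bound[where B = 1])
        show "AE \<omega> in M. norm (exp (- (s * partial_interference n \<omega>))) \<le> 1"
          using AE_h_pos by eventually_elim (simp add: partial_interference_nonneg s less_imp_le)
      qed auto
      then have int': "integrable M (\<lambda>\<omega>. exp (- (s * partial_interference n \<omega>)) * indicator (space M - B) \<omega>)"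
        by (intro integrable_real_mult_indicator) auto
      have indB: "integrable M (indicator B :: _ \<Rightarrow> real)"
        by (rule integrable_real_indicator[OF B_ev]) (simp add: less_top[symmetric])
      have expB: "expectation (indicator B) = prob B"
        using sets.Int_space_eq2[OF B_ev] by (simp only: Bochner_Integration.integral_indicator)
      have "expectation (\<lambda>\<omega>. exp (- (s * partial_interference n \<omega>))) \<le>
        expectation (\<lambda>\<omega>. indicator B \<omega> + exp (- (s * partial_interference n \<omega>)) * indicator (space M - B) \<omega>)"
      proof (rule integral_mono_AE)
        show "AE \<omega> in M. exp (- (s * partial_interference n \<omega>)) \<le>
            indicator B \<omega> + exp (- (s * partial_interference n \<omega>)) * indicator (space M - B) \<omega>"
          using AE_h_pos AE_space
          by eventually_elim (simp add: partial_interference_nonneg s less_imp_le indicator_def)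
        show "integrable M (\<lambda>\<omega>. indicator B \<omega> + exp (- (s * partial_interference n \<omega>)) * indicator (space M - B) \<omega>)"
          by (rule Bochner_Integration.integrable_add[OF indB int'])
      qed (rule int)
      also have "\<dots> = prob B + expectation (\<lambda>\<omega>. exp (- (s * partial_interference n \<omega>)) * indicator (space M - B) \<omega>)"
        unfolding Bochner_Integration.integral_add[OF indB int'] expB by (rule refl)
      finally show ?thesis .
    qed
    then show ?thesis
      by (intro LIMSEQ_le[OF partial_interference_laplace_limit[OF s] lim]) auto
  qed
  define K where "K = (\<Sum>m\<in>{1..3}. \<mu> m * (pi * P m powr (2 / \<beta>) * radial_const \<beta>))"
  \<comment> \<open>As s -> 0 the lower bound for \<open>prob B\<close> tends to 1.\<close>
  have "((\<lambda>s. exp (- (K * s powr (2 / \<beta>)))) \<longlongrightarrow> exp (- (K * 0))) (at_right 0)"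
    using \<beta> by (intro tendsto_intros tendsto_zero_powrI[where b = "2 / \<beta>"] tendsto_ident_at) (auto simp: eventually_at_filter)
  moreover have "\<forall>\<^sub>F s in at_right 0. exp (- (K * s powr (2 / \<beta>))) \<le> prob B"
    using eventually_at_right_less
  proof eventually_elim
    case (elim s)
    have "exp (- (K * s powr (2 / \<beta>))) \<le> exp (- exponent s)"
      using exponent_le[OF elim] by (simp add: K_def)
    then show ?case using lower[OF elim] by (rule order_trans)
  qed
  ultimately have "1 \<le> prob B" by (auto dest: tendsto_upperbound)
  then have "prob B = 1" using prob_le_1[of B] by simp
  then have "AE \<omega> in M. \<omega> \<in> B" by (rule AE_prob_1)
  then show ?thesis by eventually_elim (simp add: B_def)
qed

text \<open>A singleton is a null set, so its count is 0 almost surely. The purpose is a strictly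
  positive interference: since \<open>0 powr (- \<beta>) = 0\<close>, a point at the origin would
  contribute nothing.\<close>

lemma AE_Y_nonzero: "AE \<omega> in M. Y 1 0 \<omega> \<noteq> 0"
proof -
  have "(1::nat) \<in> {1..3}" by simp
  note Y1 = process[OF this]
  have "measure lborel ({0} \<inter> A 1) = 0"
    by (cases "0 \<in> A 1") auto
  then have "prob {\<omega> \<in> space M. point_count (Y 1) {0} \<omega> = 0} = 1"
    using poisson_processD(3)[OF Y1, of "{0}" 0] by simp
  then have "AE \<omega> in M. \<omega> \<in> {\<omega> \<in> space M. point_count (Y 1) {0} \<omega> = 0}" by (rule AE_prob_1)
  \<comment> \<open>A count of 0 could also stem from an infinite set, whose \<open>card\<close> is
    0; local finiteness excludes this.\<close>
  moreover have "AE \<omega> in M. finite {k. Y 1 k \<omega> \<in> {0}}"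
    by (rule poisson_processD(2)[OF Y1]) auto
  ultimately show ?thesis
    by eventually_elim (auto simp: point_count_def)
qed

text \<open>A bound on the joint partial sums gives summability tier by tier, so the
  \<open>suminf\<close> in \<open>interference\<close> has its intended value. Strict positivity
  keeps the denominator of the SINR nonzero even in the absence of noise.\<close>

lemma AE_interference:
  "AE \<omega> in M. (\<lambda>n. partial_interference n \<omega>) \<longlonglongrightarrow> interference P \<beta> h Y \<omega> \<and> interference P \<beta> h Y \<omega> > 0"
  using AE_h_pos AE_partial_interference_bounded AE_Y_nonzero
proof eventually_elim
  case (elim \<omega>)
  let ?t = "\<lambda>m k. P m * h m k \<omega> * norm (Y m k \<omega>) powr (- \<beta>)"
  obtain c :: nat where c: "\<And>n. partial_interference n \<omega> \<le> real c" using elim(2) by blast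
  have nonneg: "0 \<le> ?t m k" if "m \<in> {1..3}" for m k
    using that elim(1) P_pos by (auto simp: less_imp_le)
  have sm: "summable (?t m)" if m: "m \<in> {1..3}" for m
  proof (rule summableI_nonneg_bounded)
    fix n
    have "sum (?t m) {..<n} \<le> partial_interference n \<omega>"
      unfolding partial_interference_def using nonneg m
      by (intro member_le_sum[of m "{1..3}" "\<lambda>m. sum (?t m) {..<n}"] sum_nonneg) auto
    then show "sum (?t m) {..<n} \<le> real c" using c[of n] by simp
  qed (rule nonneg[OF m])
  have "(\<lambda>n. partial_interference n \<omega>) \<longlonglongrightarrow> interference P \<beta> h Y \<omega>"
    unfolding partial_interference_def interference_def
    by (intro tendsto_sum summable_LIMSEQ sm)
  moreover have "0 < suminf (?t 1)"
  proof (rule suminf_pos2[OF sm nonneg])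
    show "0 < ?t 1 0" using elim(1,3) P_pos[of 1] by simp
  qed auto
  then have "interference P \<beta> h Y \<omega> > 0"
    unfolding interference_def by (intro sum_pos2[where i = 1] suminf_nonneg sm nonneg) auto
  ultimately show ?case by simp
qed

lemma interference_laplace:
  assumes s: "s > 0"
  shows "(\<integral>\<^sup>+\<omega>. ennreal (exp (- (s * interference P \<beta> h Y \<omega>))) \<partial>M) = ennreal (exp (- exponent s))"
proof -
  have "(\<lambda>n. expectation (\<lambda>\<omega>. exp (- (s * partial_interference n \<omega>)))) \<longlonglongrightarrow>
      expectation (\<lambda>\<omega>. exp (- (s * interference P \<beta> h Y \<omega>)))"
  proof (rule integral_dominated_convergence[where w = "\<lambda>_. 1"])
    show "AE \<omega> in M. (\<lambda>n. exp (- (s * partial_interference n \<omega>))) \<longlonglongrightarrow> exp (- (s * interference P \<beta> h Y \<omega>))"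
      using AE_interference by eventually_elim (intro tendsto_intros, blast)
    show "AE \<omega> in M. norm (exp (- (s * partial_interference n \<omega>))) \<le> 1" for n
      using AE_h_pos by eventually_elim (simp add: partial_interference_nonneg s less_imp_le)
  qed auto
  from LIMSEQ_unique[OF this partial_interference_laplace_limit[OF s]]
  have eq: "expectation (\<lambda>\<omega>. exp (- (s * interference P \<beta> h Y \<omega>))) = exp (- exponent s)" .
  have "integrable M (\<lambda>\<omega>. exp (- (s * interference P \<beta> h Y \<omega>)))"
  proof (rule integrable_const_bound[where B = 1])
    show "AE \<omega> in M. norm (exp (- (s * interference P \<beta> h Y \<omega>))) \<le> 1"
      using AE_interference by eventually_elim (simp add: s less_imp_le)
  qed auto
  from nn_integral_eq_integral[OF this] show ?thesis by (simp add: eq)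
qed

section \<open>Separating the serving gain from the interference\<close>

definition interference_of ::
    "((nat \<times> nat) option \<Rightarrow> real) \<times> (nat \<times> nat \<Rightarrow> real^2) \<Rightarrow> real" where
  "interference_of x = (\<Sum>m\<in>{1..3}. \<Sum>k. P m * fst x (Some (m, k)) * norm (snd x (m, k)) powr (- \<beta>))"

text \<open>\<open>L\<close> is left open because the gains occur with the serving link in one place
  and without it in another.\<close>

lemma interference_of_measurable:
  assumes L: "Some ` pairs \<subseteq> L"
  shows "interference_of \<in> borel_measurable (PiM L (\<lambda>_. borel) \<Otimes>\<^sub>M PiM pairs (\<lambda>_. borel))"
  unfolding interference_of_def[abs_def]
proof (intro borel_measurable_sum borel_measurable_suminf)
  fix m k assume m: "m \<in> {1..3::nat}"
  have f1: "(\<lambda>x. fst x (Some (m, k))) \<in> borel_measurable (PiM L (\<lambda>_. borel :: real measure) \<Otimes>\<^sub>M PiM pairs (\<lambda>_. borel :: (real^2) measure))"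
    using m L by (intro measurable_compose[OF measurable_fst measurable_component_singleton]) auto
  have "(\<lambda>x. snd x (m, k)) \<in> borel_measurable (PiM L (\<lambda>_. borel :: real measure) \<Otimes>\<^sub>M PiM pairs (\<lambda>_. borel :: (real^2) measure))"
    using m by (intro measurable_compose[OF measurable_snd measurable_component_singleton]) auto
  from measurable_compose[OF this, of "\<lambda>z. norm z powr (- \<beta>)" borel]
  have f2: "(\<lambda>x. norm (snd x (m, k)) powr (- \<beta>)) \<in>
      borel_measurable (PiM L (\<lambda>_. borel :: real measure) \<Otimes>\<^sub>M PiM pairs (\<lambda>_. borel :: (real^2) measure))" by simp
  show "(\<lambda>x. P m * fst x (Some (m, k)) * norm (snd x (m, k)) powr (- \<beta>)) \<in>
      borel_measurable (PiM L (\<lambda>_. borel) \<Otimes>\<^sub>M PiM pairs (\<lambda>_. borel :: (real^2) measure))"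
    by (rule borel_measurable_times[OF borel_measurable_times[OF borel_measurable_const f1] f2])
qed

definition interferer_gains :: "'a \<Rightarrow> (nat \<times> nat) option \<Rightarrow> real" where
  "interferer_gains \<omega> = (\<lambda>l\<in>Some ` pairs. gain g h l \<omega>)"

lemma indep_g_interferer_gains:
  "indep_pair borel g (PiM (Some ` pairs) (\<lambda>_. borel)) interferer_gains"
proof -
  have "indep_pair (PiM {None} (\<lambda>_. borel)) (\<lambda>\<omega>. \<lambda>l\<in>{None}. gain g h l \<omega>)
      (PiM (Some ` pairs) (\<lambda>_. borel)) interferer_gains"
    unfolding interferer_gains_def[abs_def]
    by (rule indep_pair_restrict[OF gain_indep]) (auto simp: links_def)
  from indep_pair_compose[OF this, of "\<lambda>y. y None" borel "\<lambda>y. y"]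
  show ?thesis by (simp add: measurable_component_singleton)
qed

lemma indep_interferer_gains_positions:
  "indep_pair (PiM (Some ` pairs) (\<lambda>_. borel)) interferer_gains (PiM pairs (\<lambda>_. borel)) positions"
proof -
  have L: "Some ` pairs \<subseteq> links" by (auto simp: links_def)
  have "interferer_gains = (\<lambda>\<omega>. restrict (gains \<omega>) (Some ` pairs))"
    using L by (auto simp: interferer_gains_def gains_def fun_eq_iff)
  then show ?thesis
    using indep_pair_compose[OF indep_gains_positions measurable_restrict_subset[OF L] measurable_ident]
    by (simp only: id_apply)
qed

lemma interference_of_gains:
  "interference_of (interferer_gains \<omega>, positions \<omega>') = interference_of (gains \<omega>, positions \<omega>')"
  "interference_of (interferer_gains \<omega>, positions \<omega>) = interference P \<beta> h Y \<omega>"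
  unfolding interference_of_def interference_def
  by (auto intro!: sum.cong suminf_cong simp: interferer_gains_def gains_def positions_def image_iff)

text \<open>\<open>g\<close> must be separated from the interferer gains and the positions together,
  but the assumptions provide two splittings: all gains against the positions, and the gains among
  themselves. So the positions are frozen, \<open>g\<close> is split off from the other gains, and
  the positions are released again. In the result \<omega>' carries the interference and \<omega>
  the serving gain.\<close>

lemma log_interference_decouple:
  assumes c: "c > 0"
  shows "(\<integral>\<^sup>+\<omega>. ennreal (ln (1 + c * g \<omega> / (interference P \<beta> h Y \<omega> + N))) \<partial>M) =
    (\<integral>\<^sup>+\<omega>'. (\<integral>\<^sup>+\<omega>. ennreal (ln (1 + g \<omega> / ((interference P \<beta> h Y \<omega>' + N) / c))) \<partial>M) \<partial>M)"
proof -
  define \<Psi> where "\<Psi> w = (\<integral>\<^sup>+\<omega>. ennreal (ln (1 + g \<omega> / w)) \<partial>M)" for w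
  have \<Psi>[measurable]: "\<Psi> \<in> borel_measurable borel"
    unfolding \<Psi>_def[abs_def] by measurable
  have [measurable]: "interference_of \<in> borel_measurable (PiM links (\<lambda>_. borel) \<Otimes>\<^sub>M PiM pairs (\<lambda>_. borel))"
    by (rule interference_of_measurable) (auto simp: links_def)
  have [measurable]: "interference_of \<in> borel_measurable (PiM (Some ` pairs) (\<lambda>_. borel) \<Otimes>\<^sub>M PiM pairs (\<lambda>_. borel))"
    by (rule interference_of_measurable) simp
  have [measurable]: "(\<lambda>x. fst x None) \<in> borel_measurable (PiM links (\<lambda>_. borel) \<Otimes>\<^sub>M PiM pairs (\<lambda>_. borel :: (real^2) measure))"
    by (intro measurable_compose[OF measurable_fst measurable_component_singleton]) auto
  define F where "F x = ennreal (ln (1 + c * fst x None / (interference_of x + N)))" for x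
  have F: "F \<in> borel_measurable (PiM links (\<lambda>_. borel) \<Otimes>\<^sub>M PiM pairs (\<lambda>_. borel))"
    unfolding F_def[abs_def] by measurable
  define H where "H x = \<Psi> ((interference_of x + N) / c)" for x
  have H: "H \<in> borel_measurable (PiM (Some ` pairs) (\<lambda>_. borel) \<Otimes>\<^sub>M PiM pairs (\<lambda>_. borel))"
    unfolding H_def[abs_def] by measurable
  have "(\<integral>\<^sup>+\<omega>. ennreal (ln (1 + c * g \<omega> / (interference P \<beta> h Y \<omega> + N))) \<partial>M) = (\<integral>\<^sup>+\<omega>. F (gains \<omega>, positions \<omega>) \<partial>M)"
    by (simp add: F_def interference_of_gains(1)[symmetric] interference_of_gains(2)) (simp add: gains_def)
  also have "\<dots> = (\<integral>\<^sup>+\<omega>'. (\<integral>\<^sup>+\<omega>. F (gains \<omega>, positions \<omega>') \<partial>M) \<partial>M)"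
    by (rule indep_pair_nn_integral_iterated[OF indep_gains_positions F])
  also have "\<dots> = (\<integral>\<^sup>+\<omega>'. (\<integral>\<^sup>+\<omega>. H (interferer_gains \<omega>, positions \<omega>') \<partial>M) \<partial>M)"
  proof (rule nn_integral_cong)
    fix \<omega>'
    define F' where "F' x = ennreal (ln (1 + fst x / ((interference_of (snd x, positions \<omega>') + N) / c)))"
      for x :: "real \<times> ((nat \<times> nat) option \<Rightarrow> real)"
    have pos: "positions \<omega>' \<in> space (PiM pairs (\<lambda>_. borel))"
      by (simp add: positions_def space_PiM)
    have [measurable]: "(\<lambda>x. interference_of (snd x, positions \<omega>')) \<in> borel_measurable (borel \<Otimes>\<^sub>M PiM (Some ` pairs) (\<lambda>_. borel))"
      by (rule measurable_compose[OF measurable_Pair[OF measurable_snd measurable_const[OF pos]]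
            interference_of_measurable[OF subset_refl]])
    have F': "F' \<in> borel_measurable (borel \<Otimes>\<^sub>M PiM (Some ` pairs) (\<lambda>_. borel))"
      unfolding F'_def[abs_def] by measurable
    have "(\<integral>\<^sup>+\<omega>. F (gains \<omega>, positions \<omega>') \<partial>M) = (\<integral>\<^sup>+\<omega>. F' (g \<omega>, interferer_gains \<omega>) \<partial>M)"
      by (simp add: F_def F'_def interference_of_gains(1)) (simp add: gains_def mult.commute)
    also have "\<dots> = (\<integral>\<^sup>+\<omega>''. (\<integral>\<^sup>+\<omega>. F' (g \<omega>, interferer_gains \<omega>'') \<partial>M) \<partial>M)"
      by (rule indep_pair_nn_integral_iterated[OF indep_g_interferer_gains F'])
    also have "\<dots> = (\<integral>\<^sup>+\<omega>. H (interferer_gains \<omega>, positions \<omega>') \<partial>M)"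
      by (simp add: F'_def H_def \<Psi>_def)
    finally show "(\<integral>\<^sup>+\<omega>. F (gains \<omega>, positions \<omega>') \<partial>M) = (\<integral>\<^sup>+\<omega>. H (interferer_gains \<omega>, positions \<omega>') \<partial>M)" .
  qed
  also have "\<dots> = (\<integral>\<^sup>+\<omega>. H (interferer_gains \<omega>, positions \<omega>) \<partial>M)"
    by (rule indep_pair_nn_integral_iterated[OF indep_interferer_gains_positions H, symmetric])
  finally show ?thesis by (simp add: H_def \<Psi>_def interference_of_gains(2))
qed

lemma expected_log_rate:
  assumes c: "c > 0" and N: "N \<ge> 0"
  shows "(\<integral>\<^sup>+\<omega>. ennreal (ln (1 + c * g \<omega> / (interference P \<beta> h Y \<omega> + N))) \<partial>M) =
    (\<integral>\<^sup>+t. ennreal (exp (- ((exp t - 1) / c * N) - exponent ((exp t - 1) / c))) * indicator {0<..} t \<partial>lborel)"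
proof -
  interpret L: pair_sigma_finite M lborel ..
  let ?I = "interference P \<beta> h Y"
  have "(\<integral>\<^sup>+\<omega>. ennreal (ln (1 + c * g \<omega> / (?I \<omega> + N))) \<partial>M) =
     (\<integral>\<^sup>+\<omega>. (\<integral>\<^sup>+t. ennreal (exp (- ((exp t - 1) * ((?I \<omega> + N) / c)))) * indicator {0<..} t \<partial>lborel) \<partial>M)"
    unfolding log_interference_decouple[OF c]
  proof (rule nn_integral_cong_AE)
    \<comment> \<open>The layer-cake formula needs a positive denominator, which is guaranteed
      almost surely.\<close>
    show "AE \<omega>' in M. (\<integral>\<^sup>+\<omega>. ennreal (ln (1 + g \<omega> / ((?I \<omega>' + N) / c))) \<partial>M) =
        (\<integral>\<^sup>+t. ennreal (exp (- ((exp t - 1) * ((?I \<omega>' + N) / c)))) * indicator {0<..} t \<partial>lborel)"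
      using AE_interference by eventually_elim (intro exponential_log_expectation[OF g_exp], use c N in auto)
  qed
  also have "\<dots> = (\<integral>\<^sup>+t. (\<integral>\<^sup>+\<omega>. ennreal (exp (- ((exp t - 1) * ((?I \<omega> + N) / c)))) * indicator {0<..} t \<partial>M) \<partial>lborel)"
    by (intro L.Fubini'[symmetric]) measurable
  also have "\<dots> = (\<integral>\<^sup>+t. ennreal (exp (- ((exp t - 1) / c * N) - exponent ((exp t - 1) / c))) * indicator {0<..} t \<partial>lborel)"
  proof (rule nn_integral_cong)
    fix t :: real
    have "(\<integral>\<^sup>+\<omega>. ennreal (exp (- ((exp t - 1) * ((?I \<omega> + N) / c)))) \<partial>M) =
        ennreal (exp (- ((exp t - 1) / c * N) - exponent ((exp t - 1) / c)))" if t: "t > 0"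
    proof -
      define s where "s = (exp t - 1) / c"
      have s: "s > 0" using t c by (simp add: s_def)
      have "(exp t - 1) * ((?I \<omega> + N) / c) = s * N + s * ?I \<omega>" for \<omega>
        by (simp add: s_def add_divide_distrib distrib_left)
      then have "(\<integral>\<^sup>+\<omega>. ennreal (exp (- ((exp t - 1) * ((?I \<omega> + N) / c)))) \<partial>M) =
          (\<integral>\<^sup>+\<omega>. ennreal (exp (- (s * N))) * ennreal (exp (- (s * ?I \<omega>))) \<partial>M)"
        by (simp add: ennreal_mult[symmetric] exp_add[symmetric])
      also have "\<dots> = ennreal (exp (- (s * N))) * ennreal (exp (- exponent s))"
        by (subst nn_integral_cmult) (auto simp: interference_laplace[OF s])
      finally show ?thesis by (simp add: ennreal_mult[symmetric] exp_add[symmetric] s_def)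
    qed
    then show "(\<integral>\<^sup>+\<omega>. ennreal (exp (- ((exp t - 1) * ((?I \<omega> + N) / c)))) * indicator {0<..} t \<partial>M) =
       ennreal (exp (- ((exp t - 1) / c * N) - exponent ((exp t - 1) / c))) * indicator {0<..} t"
      by (auto split: split_indicator)
  qed
  finally show ?thesis .
qed

end

section \<open>The ergodic rate\<close>

lemma integral_kernel_plane:
  assumes \<beta>: "\<beta> > 2" and c: "c > 0"
  shows "(\<integral>z. kernel \<beta> c z * indicator UNIV z \<partial>lborel) = pi * c powr (2 / \<beta>) * radial_const \<beta>"
proof -
  have "(\<integral>\<^sup>+z. ennreal (kernel \<beta> c z) \<partial>lborel) = ennreal (pi * c powr (2 / \<beta>) * radial_const \<beta>)"
    using nn_integral_interference_kernel_plane[OF \<beta> c] by (simp add: kernel_def)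
  then show ?thesis
    using kernel_bounds(1)[of c \<beta>] c by (subst integral_eq_nn_integral) (auto simp: radial_const_def)
qed

lemma integral_kernel_outside:
  assumes \<beta>: "\<beta> > 2" and c: "c > 0" and r: "r > 0"
  shows "(\<integral>z. kernel \<beta> c z * indicator {z. norm z \<ge> r} z \<partial>lborel) = pi * r\<^sup>2 * Z1 \<beta> (c * r powr (- \<beta>))"
proof -
  have "(\<integral>\<^sup>+z. ennreal (kernel \<beta> c z * indicator {z. norm z \<ge> r} z) \<partial>lborel) = ennreal (pi * r\<^sup>2 * Z1 \<beta> (c * r powr (- \<beta>)))"
    unfolding nn_integral_interference_kernel_outside[OF assms, symmetric]
    by (intro nn_integral_cong) (auto simp: kernel_def split: split_indicator)
  then show ?thesis
    using kernel_bounds(1)[of c \<beta>] c r \<beta> by (subst integral_eq_nn_integral) (auto simp: Z1_nonneg)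
qed

lemma assoc_P_odds:
  assumes "lam i \<noteq> 0"
  shows "lam i / assoc_P lam P \<beta> i = (\<Sum>m=2..3. lam m * (P m / P i) powr (2 / \<beta>))"
  unfolding assoc_P_def divide_inverse[of "lam i"] inverse_inverse_eq sum_distrib_left
  using assms by (intro sum.cong refl) simp

text \<open>With \<open>D\<close> the weight of tiers 2 and 3, the association probability is
  \<open>lam 1 * p 1 / (lam 1 * p 1 + D)\<close>, so its odds are \<open>lam 1 * p 1 / D\<close>,
  while the sum is \<open>D / p i\<close>. The product loses \<open>D\<close>.\<close>

lemma assoc_G31_odds:
  assumes lam: "lam 1 > 0" "lam 2 > 0" "lam 3 > 0" and P: "P 1 > 0" "P 2 > 0" "P 3 > 0" "P i > 0"
  shows "(\<Sum>m=2..3. lam m * (P m / P i) powr (2 / \<beta>)) * (assoc_G31 lam P \<beta> / (1 - assoc_G31 lam P \<beta>))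
    = lam 1 * (P 1 / P i) powr (2 / \<beta>)"
proof -
  define p where "p m = P m powr (2 / \<beta>)" for m
  define D where "D = lam 2 * p 2 + lam 3 * p 3"
  have sums: "{1..3} = {1, 2, 3::nat}" "{2..3} = {2, 3::nat}" by auto
  have p: "p 1 > 0" "p 2 > 0" "p 3 > 0" "p i > 0" using P by (simp_all add: p_def)
  then have D: "D > 0" using lam by (simp add: D_def add_pos_pos)
  have "(\<Sum>m=1..3. lam m / lam 1 * (P m / P 1) powr (2 / \<beta>)) = (lam 1 * p 1 + D) / (lam 1 * p 1)"
    unfolding sums using P lam p by (simp add: powr_divide p_def[symmetric] D_def add_divide_distrib)
  then have G: "assoc_G31 lam P \<beta> = lam 1 * p 1 / (lam 1 * p 1 + D)" by (simp add: assoc_G31_def)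
  have pos: "lam 1 * p 1 + D > 0" using D p lam by (simp add: add_pos_pos)
  then have "1 - assoc_G31 lam P \<beta> = D / (lam 1 * p 1 + D)"
    unfolding G by (simp add: field_simps)
  then have "assoc_G31 lam P \<beta> / (1 - assoc_G31 lam P \<beta>) = lam 1 * p 1 / D"
    unfolding G using pos by simp
  moreover have "(\<Sum>m=2..3. lam m * (P m / P i) powr (2 / \<beta>)) = D / p i"
    unfolding sums using P by (simp add: powr_divide p_def[symmetric] D_def add_divide_distrib)
  ultimately show ?thesis
    using D p P by (simp add: powr_divide p_def[symmetric])
qed

lemma case2_rayleigh_network:
  assumes law: "case2_law lam' P \<beta> i g h Y x S" and \<beta>: "\<beta> > 2"
    and P: "\<And>m. m \<in> {1..3} \<Longrightarrow> P m > 0" and lam': "\<And>m. m \<in> {1..3} \<Longrightarrow> lam' m \<ge> 0"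
  shows "rayleigh_network S P lam' \<beta> (interferer_region P \<beta> i x) g h Y"
proof (intro rayleigh_network.intro rayleigh_network_axioms.intro)
  show "interferer_region P \<beta> i x m \<in> sets borel" for m
    unfolding interferer_region_def by (auto intro!: borel_closed closed_Collect_le continuous_intros)
qed (use assms in \<open>auto simp: case2_law_def\<close>)

text \<open>The exclusion radius r = x (P m / P i)^(1/\<beta>) is where a node of tier
  \<open>m\<close> has the same mean received power as the serving node. Hence s P m r^(-\<beta>) =
  T for tiers 2 and 3 alike, and they share the value \<open>Z1 \<beta> T\<close>, weighted by
  r^2.\<close>

lemma (in rayleigh_network) exponent_case2:
  assumes A: "A = interferer_region P \<beta> i x" and i: "i \<in> {1..3}" and x: "x > 0" and T: "T > 0"
  shows "exponent (T / (P i * x powr (- \<beta>))) =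
    pi * x\<^sup>2 * ((\<Sum>m=2..3. \<mu> m * (P m / P i) powr (2 / \<beta>)) * Z1 \<beta> T
      + \<mu> 1 * (P 1 / P i) powr (2 / \<beta>) * (T powr (2 / \<beta>) * radial_const \<beta>))"
proof -
  define s where "s = T / (P i * x powr (- \<beta>))"
  have s: "s > 0" using T P_pos[OF i] x by (simp add: s_def)
  have xb: "(x powr \<beta>) powr (2 / \<beta>) = x\<^sup>2" using x \<beta> by (simp add: powr_powr)
  have sP: "s * P m = T * x powr \<beta> * (P m / P i)" for m
    by (simp add: s_def powr_minus field_simps)
  have m1: "(\<integral>z. kernel \<beta> (s * P 1) z * indicator (A 1) z \<partial>lborel) =
      pi * x\<^sup>2 * ((P 1 / P i) powr (2 / \<beta>) * (T powr (2 / \<beta>) * radial_const \<beta>))"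
  proof -
    have "A 1 = UNIV" by (simp add: A interferer_region_def)
    then have "(\<integral>z. kernel \<beta> (s * P 1) z * indicator (A 1) z \<partial>lborel) = pi * (s * P 1) powr (2 / \<beta>) * radial_const \<beta>"
      using integral_kernel_plane[OF \<beta>, of "s * P 1"] s P_pos[of 1] by simp
    also have "(s * P 1) powr (2 / \<beta>) = T powr (2 / \<beta>) * x\<^sup>2 * (P 1 / P i) powr (2 / \<beta>)"
      unfolding sP using T x P_pos[of 1] P_pos[OF i] by (simp add: powr_mult powr_divide xb)
    finally show ?thesis by (simp add: mult_ac)
  qed
  have m23: "(\<integral>z. kernel \<beta> (s * P m) z * indicator (A m) z \<partial>lborel) = pi * x\<^sup>2 * ((P m / P i) powr (2 / \<beta>) * Z1 \<beta> T)"
    if m: "m \<in> {2..3}" for m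
  proof -
    define r where "r = x * (P m / P i) powr (1 / \<beta>)"
    have Pm: "P m > 0" using P_pos m by simp
    have r: "r > 0" using x Pm P_pos[OF i] by (simp add: r_def)
    have "((P m / P i) powr (1 / \<beta>)) powr (- \<beta>) = P i / P m"
      using Pm P_pos[OF i] \<beta> by (simp add: powr_powr powr_minus)
    then have rT: "s * P m * r powr (- \<beta>) = T"
      unfolding r_def sP using x Pm P_pos[OF i] by (subst powr_mult) (auto simp: powr_minus field_simps)
    have "((P m / P i) powr (1 / \<beta>))\<^sup>2 = (P m / P i) powr (2 / \<beta>)"
      by (simp add: power2_eq_square powr_add[symmetric])
    then have r2: "r\<^sup>2 = x\<^sup>2 * (P m / P i) powr (2 / \<beta>)"
      by (simp add: r_def power_mult_distrib)
    have "A m = {z. norm z \<ge> r}" using m by (auto simp: A interferer_region_def r_def)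
    then show ?thesis
      using integral_kernel_outside[OF \<beta> _ r, of "s * P m"] s Pm unfolding rT r2 by (simp add: mult_ac)
  qed
  have sums: "{1..3} = insert 1 {2..3::nat}" by auto
  have "exponent s = \<mu> 1 * (pi * x\<^sup>2 * ((P 1 / P i) powr (2 / \<beta>) * (T powr (2 / \<beta>) * radial_const \<beta>)))
      + (\<Sum>m=2..3. \<mu> m * (pi * x\<^sup>2 * ((P m / P i) powr (2 / \<beta>) * Z1 \<beta> T)))"
    unfolding exponent_def sums m1[symmetric] by (subst sum.insert) (simp_all add: m23)
  also have "(\<Sum>m=2..3. \<mu> m * (pi * x\<^sup>2 * ((P m / P i) powr (2 / \<beta>) * Z1 \<beta> T))) =
      pi * x\<^sup>2 * ((\<Sum>m=2..3. \<mu> m * (P m / P i) powr (2 / \<beta>)) * Z1 \<beta> T)"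
    unfolding sum_distrib_left sum_distrib_right by (intro sum.cong refl) (simp add: mult_ac)
  finally show ?thesis unfolding s_def by (simp add: algebra_simps)
qed

theorem theorem2:
  fixes lam P :: "nat \<Rightarrow> real" and \<alpha> \<beta> \<gamma> \<sigma> :: real and N M1 i :: nat
    and M :: "'w measure" and X :: "'w \<Rightarrow> real" and K :: "real \<Rightarrow> 'w measure"
    and g :: "'w \<Rightarrow> real" and h :: "nat \<Rightarrow> nat \<Rightarrow> 'w \<Rightarrow> real"
    and Y :: "nat \<Rightarrow> nat \<Rightarrow> 'w \<Rightarrow> real^2"
  assumes "lam 0 > lam 2" "lam 2 > lam 3" "lam 3 > 0"
    and "0 < \<alpha>" "\<alpha> < 1" "lam 1 = \<alpha> * lam 0"
    and "P 1 > 0" "P 2 > 0" "P 3 > 0"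
    and "\<beta> > 2" "\<sigma> \<ge> 0" "\<gamma> \<ge> 0"
    and "1 \<le> M1" "M1 \<le> N"
    and "i \<in> {2, 3}"
    and "prob_space M"
    and "distributed M lborel X (\<lambda>x. ennreal (serving_density lam P \<beta> i x))"
    and "regular_conditional M X K"
    and "AE x in distr M borel X.
           case2_law (active_density lam P \<beta> \<alpha> \<gamma> N M1) P \<beta> i g h Y x (K x)"
  shows "ergodic_rate lam P \<beta> \<sigma> i K g h Y =
    ennreal (2 * pi * lam i / assoc_P lam P \<beta> i) *
    (\<integral>\<^sup>+x\<in>{0<..}. (\<integral>\<^sup>+t\<in>{0<..}. ennreal (x * exp (
        - (x powr \<beta> * inverse (P i) * (exp t - 1) * \<sigma>\<^sup>2)
        - pi * lam i * x\<^sup>2 / assoc_P lam P \<beta> i *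
          (1 + Z1 \<beta> (exp t - 1)
             + active_density lam P \<beta> \<alpha> \<gamma> N M1 1 / lam 1
               * (assoc_G31 lam P \<beta> / (1 - assoc_G31 lam P \<beta>)) * Z2 \<beta> t)))
      \<partial>lborel) \<partial>lborel)"
proof -
  note \<beta> = \<open>\<beta> > 2\<close>
  define \<mu> where "\<mu> = active_density lam P \<beta> \<alpha> \<gamma> N M1"
  define Q where "Q = (\<Sum>m=2..3. lam m * (P m / P i) powr (2 / \<beta>))"
  define R where "R = assoc_G31 lam P \<beta> / (1 - assoc_G31 lam P \<beta>)"
  have lam: "lam 0 > 0" "lam 1 > 0" "lam 2 > 0" "lam 3 > 0" using assms by auto
  have i: "i \<in> {1..3}" "lam i > 0" "P i > 0" using assms lam by auto
  have P: "P m > 0" if "m \<in> {1..3}" for m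
  proof -
    have "m = 1 \<or> m = 2 \<or> m = 3" using that by auto
    then show ?thesis using assms by auto
  qed
  have lam_pos: "lam m > 0" if "m \<in> {1..3}" for m
  proof -
    have "m = 1 \<or> m = 2 \<or> m = 3" using that by auto
    then show ?thesis using lam by auto
  qed
  have \<mu>0: "\<mu> m \<ge> 0" if "m \<in> {1..3}" for m
  proof (cases "m = 1")
    case True
    have "cache_mass N \<gamma> M1 \<ge> 0"
      unfolding cache_mass_def zipf_def by (intro sum_nonneg divide_nonneg_nonneg) auto
    moreover have "assoc_G31 lam P \<beta> \<ge> 0"
      unfolding assoc_G31_def inverse_nonnegative_iff_nonnegative
      by (intro sum_nonneg mult_nonneg_nonneg divide_nonneg_nonneg powr_ge_zero) (use lam_pos lam(2) in \<open>auto simp: less_imp_le\<close>)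
    ultimately show ?thesis using True lam assms by (auto simp: \<mu>_def active_density_def)
  next
    case False
    then have "m = 2 \<or> m = 3" using that by auto
    then show ?thesis using lam by (auto simp: \<mu>_def active_density_def)
  qed
  have \<mu>23: "(\<Sum>m=2..3. \<mu> m * (P m / P i) powr (2 / \<beta>)) = Q"
    unfolding Q_def by (rule sum.cong) (auto simp: \<mu>_def active_density_def)
  have Q: "lam i / assoc_P lam P \<beta> i = Q"
    unfolding Q_def using i by (intro assoc_P_odds) simp
  have QR: "Q * R = lam 1 * (P 1 / P i) powr (2 / \<beta>)"
    unfolding Q_def R_def using lam P assms i by (intro assoc_G31_odds) auto
  have Q0: "Q > 0"
    unfolding Q_def
  proof (intro sum_pos mult_pos_pos)
    fix m :: nat assume "m \<in> {2..3}"
    then have "m \<in> {1..3}" by simp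
    then show "lam m > 0" "(P m / P i) powr (2 / \<beta>) > 0" using lam_pos[of m] P[of m] i(3) by simp_all
  qed auto
  have coeff: "2 * pi * lam i / assoc_P lam P \<beta> i = 2 * pi * Q"
    by (simp only: times_divide_eq_right[symmetric] Q)
  have density: "serving_density lam P \<beta> i x = 2 * pi * Q * (x * exp (- (pi * x\<^sup>2 * Q)))" if "x > 0" for x
    using that unfolding serving_density_def Q_def[symmetric] coeff by simp

  text \<open>A version of \<open>\<lambda>t. Z1 \<beta> (exp t - 1)\<close> whose measurability is evident.\<close>
  define z where "z t = enn2real (\<integral>\<^sup>+w. ennreal (1 / (1 + w powr (\<beta> / 2) / (exp t - 1))) * indicator {1..} w \<partial>lborel)" for t
  have z: "Z1 \<beta> (exp t - 1) = z t" if "t > 0" for t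
    using that \<beta> by (simp add: z_def nn_integral_eq_Z1 Z1_nonneg)
  have [measurable]: "z \<in> borel_measurable borel" unfolding z_def[abs_def] by measurable
  \<comment> \<open>\<open>V\<close> is the bracket of the theorem without its summand 1 (for
    \<open>t > 0\<close>), \<open>E\<close> the factor due to noise and interference, and
    \<open>W\<close> includes the serving density without its constant \<open>2 * pi * Q\<close>.
    The exponent of that density supplies the 1.\<close>
  define V where "V t = z t + \<mu> 1 / lam 1 * R * ((exp t - 1) powr (2 / \<beta>) * radial_const \<beta>)" for t
  define E where "E x t = exp (- (x powr \<beta> * inverse (P i) * (exp t - 1) * \<sigma>\<^sup>2) - pi * Q * x\<^sup>2 * V t)" for x t
  define W where "W x t = x * exp (- (pi * x\<^sup>2 * Q)) * E x t" for x t
  have [measurable]: "V \<in> borel_measurable borel" unfolding V_def[abs_def] by measurable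
  have E[measurable]: "(\<lambda>(x, t). E x t) \<in> borel_measurable (borel \<Otimes>\<^sub>M borel)" unfolding E_def by measurable
  have W[measurable]: "(\<lambda>(x, t). W x t) \<in> borel_measurable (borel \<Otimes>\<^sub>M borel)" unfolding W_def E_def by measurable

  have rate: "(\<integral>\<^sup>+\<omega>. ennreal (ln (1 + sinr P \<beta> \<sigma> i g h Y x \<omega>)) \<partial>K x) = (\<integral>\<^sup>+t\<in>{0<..}. ennreal (E x t) \<partial>lborel)"
    if x: "x > 0" and law: "case2_law \<mu> P \<beta> i g h Y x (K x)" for x
  proof -
    interpret rayleigh_network "K x" P \<mu> \<beta> "interferer_region P \<beta> i x" g h Y
      using case2_rayleigh_network[OF law \<beta> P \<mu>0] .
    define c where "c = P i * x powr (- \<beta>)"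
    have c: "c > 0" using x i by (simp add: c_def)
    have "(\<integral>\<^sup>+\<omega>. ennreal (ln (1 + sinr P \<beta> \<sigma> i g h Y x \<omega>)) \<partial>K x) =
      (\<integral>\<^sup>+\<omega>. ennreal (ln (1 + c * g \<omega> / (interference P \<beta> h Y \<omega> + \<sigma>\<^sup>2))) \<partial>K x)"
      by (simp add: sinr_def c_def mult_ac)
    also have "\<dots> = (\<integral>\<^sup>+t\<in>{0<..}. ennreal (exp (- ((exp t - 1) / c * \<sigma>\<^sup>2) - exponent ((exp t - 1) / c))) \<partial>lborel)"
      by (rule expected_log_rate[OF c]) simp
    also have "\<dots> = (\<integral>\<^sup>+t\<in>{0<..}. ennreal (E x t) \<partial>lborel)"
    proof (rule nn_integral_cong)
      fix t :: real
      have "exp (- ((exp t - 1) / c * \<sigma>\<^sup>2) - exponent ((exp t - 1) / c)) = E x t" if t: "t > 0"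
      proof -
        have a: "(exp t - 1) / c * \<sigma>\<^sup>2 = x powr \<beta> * inverse (P i) * (exp t - 1) * \<sigma>\<^sup>2"
          by (simp add: c_def powr_minus divide_inverse mult_ac)
        \<comment> \<open>Multiplication by \<open>Q\<close> turns the odds \<open>R\<close> back
          into the tier-1 weight that \<open>exponent_case2\<close> produces.\<close>
        have "Q * (\<mu> 1 / lam 1 * R) = \<mu> 1 / lam 1 * (Q * R)" by (rule mult.left_commute)
        then have "Q * (\<mu> 1 / lam 1 * R) = \<mu> 1 * (P 1 / P i) powr (2 / \<beta>)"
          unfolding QR using lam by simp
        moreover have "Q * V t = Q * z t + Q * (\<mu> 1 / lam 1 * R) * ((exp t - 1) powr (2 / \<beta>) * radial_const \<beta>)"
          by (simp only: V_def distrib_left mult.assoc)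
        ultimately have "Q * V t = Q * z t + \<mu> 1 * (P 1 / P i) powr (2 / \<beta>) * ((exp t - 1) powr (2 / \<beta>) * radial_const \<beta>)"
          by (simp only:)
        then have "exponent ((exp t - 1) / c) = pi * x\<^sup>2 * (Q * V t)"
          using exponent_case2[OF refl i(1) x, of "exp t - 1"] t
          unfolding c_def \<mu>23 z[OF t] by simp
        then have b: "exponent ((exp t - 1) / c) = pi * Q * x\<^sup>2 * V t"
          by (simp only: mult_ac)
        show ?thesis unfolding E_def a b ..
      qed
      then show "ennreal (exp (- ((exp t - 1) / c * \<sigma>\<^sup>2) - exponent ((exp t - 1) / c))) * indicator {0<..} t =
          ennreal (E x t) * indicator {0<..} t"
        by (auto split: split_indicator)
    qed
    finally show ?thesis .
  qed

  have "AE x in density lborel (\<lambda>x. ennreal (serving_density lam P \<beta> i x)). case2_law \<mu> P \<beta> i g h Y x (K x)"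
  proof -
    have "distr M borel X = distr M lborel X" by (rule distr_cong) auto
    then have "distr M borel X = density lborel (\<lambda>x. ennreal (serving_density lam P \<beta> i x))"
      using distributed_distr_eq_density[OF assms(17)] by simp
    then show ?thesis using assms(19) unfolding \<mu>_def by (simp only:)
  qed
  then have AE: "AE x in lborel. 0 < ennreal (serving_density lam P \<beta> i x) \<longrightarrow> case2_law \<mu> P \<beta> i g h Y x (K x)"
    by (subst (asm) AE_density) (auto simp: serving_density_def[abs_def])
  have "ergodic_rate lam P \<beta> \<sigma> i K g h Y =
    (\<integral>\<^sup>+x. ennreal (2 * pi * Q) * ((\<integral>\<^sup>+t\<in>{0<..}. ennreal (W x t) \<partial>lborel) * indicator {0<..} x) \<partial>lborel)"
    unfolding ergodic_rate_def
  proof (rule nn_integral_cong_AE)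
    from AE show "AE x in lborel. (\<integral>\<^sup>+\<omega>. ennreal (ln (1 + sinr P \<beta> \<sigma> i g h Y x \<omega>)) \<partial>K x)
        * ennreal (serving_density lam P \<beta> i x) * indicator {0<..} x =
      ennreal (2 * pi * Q) * ((\<integral>\<^sup>+t\<in>{0<..}. ennreal (W x t) \<partial>lborel) * indicator {0<..} x)"
    proof eventually_elim
      case (elim x)
      show ?case
      proof (cases "x > 0")
        case x: True
        \<comment> \<open>The density is positive on the whole open half-line, so a property that
          holds almost surely for \<open>X\<close> holds for Lebesgue-almost every
          \<open>x > 0\<close>.\<close>
        then have "serving_density lam P \<beta> i x > 0" using Q0 by (simp add: density)
        then have law: "case2_law \<mu> P \<beta> i g h Y x (K x)" using elim by simp
        let ?y = "x * exp (- (pi * x\<^sup>2 * Q))"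
        have "ennreal (W x t) = ennreal ?y * ennreal (E x t)" for t
          unfolding W_def by (rule ennreal_mult) (use x in \<open>auto simp: E_def\<close>)
        then have "(\<integral>\<^sup>+t\<in>{0<..}. ennreal (W x t) \<partial>lborel) =
            (\<integral>\<^sup>+t. ennreal ?y * (ennreal (E x t) * indicator {0<..} t) \<partial>lborel)"
          by (simp only: mult.assoc)
        also have "\<dots> = ennreal ?y * (\<integral>\<^sup>+t\<in>{0<..}. ennreal (E x t) \<partial>lborel)"
          unfolding E_def by (rule nn_integral_cmult) measurable
        finally have W_eq: "(\<integral>\<^sup>+t\<in>{0<..}. ennreal (W x t) \<partial>lborel) =
            ennreal ?y * (\<integral>\<^sup>+t\<in>{0<..}. ennreal (E x t) \<partial>lborel)" .
        have "ennreal (serving_density lam P \<beta> i x) = ennreal (2 * pi * Q) * ennreal ?y"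
          unfolding density[OF x] by (rule ennreal_mult) (use x Q0 in auto)
        then show ?thesis
          unfolding rate[OF x law] W_eq by (simp only: mult_ac)
      qed simp
    qed
  qed
  also have "\<dots> = ennreal (2 * pi * Q) * (\<integral>\<^sup>+x\<in>{0<..}. (\<integral>\<^sup>+t\<in>{0<..}. ennreal (W x t) \<partial>lborel) \<partial>lborel)"
    by (rule nn_integral_cmult) measurable
  also have "(\<integral>\<^sup>+x\<in>{0<..}. (\<integral>\<^sup>+t\<in>{0<..}. ennreal (W x t) \<partial>lborel) \<partial>lborel) =
    (\<integral>\<^sup>+x\<in>{0<..}. (\<integral>\<^sup>+t\<in>{0<..}. ennreal (x * exp (
        - (x powr \<beta> * inverse (P i) * (exp t - 1) * \<sigma>\<^sup>2)
        - pi * lam i * x\<^sup>2 / assoc_P lam P \<beta> i *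
          (1 + Z1 \<beta> (exp t - 1)
             + active_density lam P \<beta> \<alpha> \<gamma> N M1 1 / lam 1
               * (assoc_G31 lam P \<beta> / (1 - assoc_G31 lam P \<beta>)) * Z2 \<beta> t)))
      \<partial>lborel) \<partial>lborel)"
  proof (rule nn_integral_cong, rule arg_cong2[where f = "(*)", OF _ refl], rule nn_integral_cong)
    fix x t :: real
    \<comment> \<open>\<open>z\<close> stands for \<open>Z1\<close> at positive \<open>t\<close>,
      hence the comparison under the indicator.\<close>
    have "W x t = x * exp (
        - (x powr \<beta> * inverse (P i) * (exp t - 1) * \<sigma>\<^sup>2)
        - pi * lam i * x\<^sup>2 / assoc_P lam P \<beta> i *
          (1 + Z1 \<beta> (exp t - 1) + \<mu> 1 / lam 1 * R * Z2 \<beta> t))" if t: "t > 0"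
    proof -
      have "pi * lam i * x\<^sup>2 / assoc_P lam P \<beta> i = pi * x\<^sup>2 * (lam i / assoc_P lam P \<beta> i)" by simp
      then show ?thesis
        unfolding W_def E_def V_def z[OF t] Z2_eq[OF \<beta>] Q mult.assoc[of x] mult_exp_exp
        by (intro arg_cong[where f = "\<lambda>y. x * exp y"]) (simp add: algebra_simps)
    qed
    then show "ennreal (W x t) * indicator {0<..} t = ennreal (x * exp (
        - (x powr \<beta> * inverse (P i) * (exp t - 1) * \<sigma>\<^sup>2)
        - pi * lam i * x\<^sup>2 / assoc_P lam P \<beta> i *
          (1 + Z1 \<beta> (exp t - 1) + active_density lam P \<beta> \<alpha> \<gamma> N M1 1 / lam 1
               * (assoc_G31 lam P \<beta> / (1 - assoc_G31 lam P \<beta>)) * Z2 \<beta> t))) * indicator {0<..} t"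
      by (auto simp: \<mu>_def R_def split: split_indicator)
  qed
  finally show ?thesis unfolding coeff .
qed

end
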